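(* Let $m\ge1$ be an integer, $d=2m+1$, $n=d^2-2$, and let $X\subset\mathbb{R}^n$ with $X\cap-X=\emptyset$ be such that $X\sqcup-X\subset\{x:(x,x)=d\}$ is a tight spherical $5$-design. Let $\Lambda=\langle X\rangle_{\mathbb{Z}}$, let $\Lambda_+=\{\sum_{x\in X}c_xx : c_x\in\mathbb{Z},\ \sum_x c_x\text{ even}\}$ and $\Gamma:=\frac{1}{\sqrt2}\Lambda_+$. Assume that $m(m+1)$ is not divisible by the square of an odd prime and that $m$ is even but not divisible by $8$. Then $\Gamma^*/\Gamma\cong\mathbb{Z}/6\mathbb{Z}$ and $m\equiv-1\pmod 3$.
   Context: A spherical $t$-design on a sphere is a finite set on which every polynomial of degree $\le t$ has the same average as over the sphere. A spherical $5$-design $Y\subset\mathbb{R}^n$ is tight if $|Y|=2\binom{n+1}{2}$; for $n>3$ such designs are antipodal, exist only for $n=(2m+1)^2-2$, and when scaled to norm $d=2m+1$ have inner products $\pm1$ between distinct non-antipodal points; $\Gamma$ is then an integral lattice. $\Gamma^*$ is the dual lattice of $\Gamma$. *)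

theory Defs
  imports
    "HOL-Analysis.Analysis"
    "HOL-Algebra.Elementary_Groups"
    "HOL-Algebra.Coset"
    "HOL-Number_Theory.Cong"
    "HOL-Computational_Algebra.Primes"
begin

definition polynomial_of_degree_le :: "nat \<Rightarrow> (real ^ 'n \<Rightarrow> real) \<Rightarrow> bool" where
  "polynomial_of_degree_le t f \<longleftrightarrow>
     (\<exists>c :: ('n \<Rightarrow> nat) \<Rightarrow> real. \<forall>x.
        f x = (\<Sum>\<alpha> | sum \<alpha> UNIV \<le> t. c \<alpha> * (\<Prod>i\<in>UNIV. (x $ i) ^ \<alpha> i)))"

text \<open>The sum above ranges over a finite set of exponent vectors, so it is a genuine sum.\<close>

lemma finite_exponents_degree_le: "finite {\<alpha> :: 'n::finite \<Rightarrow> nat. sum \<alpha> UNIV \<le> t}"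
proof (rule finite_subset)
  show "{\<alpha> :: 'n \<Rightarrow> nat. sum \<alpha> UNIV \<le> t} \<subseteq> Pi\<^sub>E UNIV (\<lambda>_. {..t})"
  proof (intro subsetI PiE_I)
    fix \<alpha> :: "'n \<Rightarrow> nat" and i
    assume "\<alpha> \<in> {\<alpha>. sum \<alpha> UNIV \<le> t}"
    moreover have "\<alpha> i \<le> sum \<alpha> UNIV" by (rule member_le_sum) auto
    ultimately show "\<alpha> i \<in> {..t}" by simp
  qed auto
qed (simp add: finite_PiE)

text \<open>The normalised surface measure on the sphere of radius \<open>r > 0\<close> about the origin, as the
  cone measure: the image of the uniform distribution on the unit ball under radial projection.\<close>

definition sphere_measure :: "real \<Rightarrow> 'a::euclidean_space measure" where
  "sphere_measure r = distr (uniform_measure lborel (ball 0 1)) borel (\<lambda>x. r *\<^sub>R sgn x)"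

lemma sphere_projection_measurable [measurable]:
  "(\<lambda>x :: 'a::euclidean_space. r *\<^sub>R sgn x) \<in> borel_measurable borel"
  unfolding sgn_div_norm by measurable

lemma emeasure_sphere_measure_sphere:
  assumes "r > 0"
  shows "emeasure (sphere_measure r :: 'a::euclidean_space measure) (sphere 0 r) = 1"
proof -
  let ?U = "uniform_measure lborel (ball (0::'a) 1)"
  let ?P = "\<lambda>x::'a. r *\<^sub>R sgn x"
  have pos: "emeasure lborel (ball (0::'a) 1) \<noteq> 0"
    using content_ball_pos[of 1 "0::'a"] by (auto simp: measure_def)
  have fin: "emeasure lborel (ball (0::'a) 1) \<noteq> \<infinity>"
    using emeasure_lborel_ball_finite[of "0::'a" 1] by auto
  have eq: "?P -` sphere 0 r = - {0}"
    using assms by (auto simp: norm_sgn)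
  have "emeasure (sphere_measure r) (sphere (0::'a) r) = emeasure ?U (- {0})"
    unfolding sphere_measure_def by (subst emeasure_distr) (auto simp: space_uniform_measure eq)
  also have "\<dots> = emeasure lborel (ball 0 1 \<inter> - {0::'a}) / emeasure lborel (ball (0::'a) 1)"
    by (rule emeasure_uniform_measure) auto
  also have "emeasure lborel (ball 0 1 \<inter> - {0::'a}) = emeasure lborel (ball 0 1 - {0::'a})"
    by (simp add: Diff_eq)
  also have "\<dots> = emeasure lborel (ball (0::'a) 1)"
    by (rule emeasure_Diff_null_set) auto
  also have "\<dots> / emeasure lborel (ball (0::'a) 1) = 1"
    using pos fin by (simp add: top.not_eq_extremum)
  finally show ?thesis .
qed

text \<open>Averages over the empty set are \<open>0\<close> here, so the constant polynomial \<open>1\<close> excludes \<open>Y = {}\<close>.\<close>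

definition spherical_design :: "nat \<Rightarrow> real \<Rightarrow> (real ^ 'n) set \<Rightarrow> bool" where
  "spherical_design t r Y \<longleftrightarrow> finite Y \<and> Y \<subseteq> sphere 0 r \<and>
     (\<forall>f. polynomial_of_degree_le t f \<longrightarrow>
        (\<Sum>y\<in>Y. f y) / real (card Y) = (LINT x|sphere_measure r. f x))"

definition tight_spherical_5_design :: "real \<Rightarrow> (real ^ 'n) set \<Rightarrow> bool" where
  "tight_spherical_5_design r Y \<longleftrightarrow>
     spherical_design 5 r Y \<and> card Y = 2 * ((CARD('n) + 1) choose 2)"

text \<open>In the two definitions below \<open>X\<close> is meant to be finite.\<close>

definition int_span :: "'a::real_vector set \<Rightarrow> 'a set" where
  "int_span X = {\<Sum>x\<in>X. of_int (c x) *\<^sub>R x | c :: 'a \<Rightarrow> int. True}"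

definition even_int_span :: "'a::real_vector set \<Rightarrow> 'a set" where
  "even_int_span X = {\<Sum>x\<in>X. of_int (c x) *\<^sub>R x | c :: 'a \<Rightarrow> int. even (\<Sum>x\<in>X. c x)}"

text \<open>The dual of a lattice \<open>L\<close> that spans the whole ambient space.\<close>

definition dual_lattice :: "'a::real_inner set \<Rightarrow> 'a set" where
  "dual_lattice L = {y. \<forall>x\<in>L. y \<bullet> x \<in> \<int>}"

definition additive_group :: "'a::ab_group_add set \<Rightarrow> 'a monoid" where
  "additive_group A = \<lparr>carrier = A, monoid.mult = (+), one = 0\<rparr>"

end

theory Submission
  imports Defs
begin

text \<open>The second and fourth moments of the design give the inner products \<open>\<plusminus>1\<close> in \<open>X\<close>, whence \<open>\<Gamma>\<close> is an even
  lattice. Put \<open>U = X / \<surd>2\<close>, let \<open>K\<close> consist of the vectors with integral inner products with \<open>U\<close>, and let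
  \<open>u \<in> U\<close>. Then \<open>\<Gamma>\<^sup>* = K \<union> (u + K)\<close> and \<open>u \<notin> K\<close>. For \<open>y \<in> K\<close> the moment identities and \<open>12 | k^4 - k^2\<close> show,
  under the arithmetic hypotheses on \<open>m\<close>, that \<open>b = 3 (y, y) / 2\<close> is an integer congruent to \<open>0\<close> or \<open>d\<close>
  modulo 3. Since \<open>\<Gamma>\<close> is its own double dual, \<open>K / \<Gamma>\<close> is a nondegenerate quadratic space over the field with
  3 elements whose form takes at most one nonzero value, so it has dimension at most 1. Milgram's formula
  for the phase of the Gauss sum of \<open>\<Gamma>\<^sup>* / \<Gamma>\<close>, together with \<open>n = -1\<close> modulo 8, excludes dimension 0 and
  determines \<open>d\<close> modulo 3. Milgram's formula itself reduces, through a sublattice with an orthogonal basis,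
  to the quadratic Gauss sums evaluated by Gauss's identity for q-binomial coefficients.\<close>

text \<open>How the conditions on \<open>m\<close> act: evenness of \<open>m\<close> makes the Gram
  form of even combinations even, since its diagonal is \<open>m\<close> up to a common
  \<open>1/2\<close>, and it gives \<open>n = 4 m (m + 1) - 1 = -1\<close> modulo 8. The other two
  conditions feed the identity \<open>m (m + 1) b (b - d) = 18 z\<close>. An odd prime in the
  denominator of \<open>b\<close> would have its square dividing \<open>m (m + 1)\<close>, a factor
  2 there would make 8 divide \<open>m\<close>, and if 3 did not divide \<open>b (b - d)\<close>
  then 9 would divide \<open>m (m + 1)\<close>. No integral over the sphere is ever evaluated.
  Rotation invariance makes the power sums of a design depend only on the length of the direction,
  and comparison with coordinate vectors yields the constants. In the same spirit only phases of
  Gauss sums are tracked: positive factors stay unspecified, and in the end only the signs of the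
  real and imaginary parts matter.\<close>

subsection \<open>Moments of spherical designs\<close>

text \<open>Uniqueness of translation-invariant measures: Fubini's theorem for \<open>1\<^sub>A (f x) 1\<^sub>B (f x - y)\<close>, where the ball
  \<open>B\<close> is invariant under \<open>f\<close>.\<close>

lemma distr_lborel_orthogonal_transformation:
  fixes f :: "'a::euclidean_space \<Rightarrow> 'a"
  assumes f: "orthogonal_transformation f"
  shows "distr lborel borel f = lborel"
proof (rule measure_eqI)
  fix A :: "'a set"
  assume "A \<in> sets (distr lborel borel f)"
  then have A [measurable]: "A \<in> sets borel" by simp
  have lin: "linear f" using f by (simp add: orthogonal_transformation_linear)
  have [measurable]: "f \<in> borel_measurable borel"
    using lin by (simp add: borel_measurable_continuous_onI linear_continuous_on linear_linear)
  define B where "B = ball (0::'a) 1"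
  have [measurable]: "B \<in> sets borel" by (simp add: B_def)
  define \<beta> where "\<beta> = emeasure lborel B"
  have \<beta>: "\<beta> \<noteq> 0" "\<beta> \<noteq> \<infinity>"
    using content_ball_pos[of 1 "0::'a"] emeasure_lborel_ball_finite[of "0::'a" 1]
    by (auto simp: \<beta>_def B_def measure_def)
  have B: "f x \<in> B \<longleftrightarrow> x \<in> B" "- x \<in> B \<longleftrightarrow> x \<in> B" for x
    using orthogonal_transformation_norm[OF f] by (auto simp: B_def)
  have shift: "(\<integral>\<^sup>+ x. g (a + x) \<partial>lborel) = (\<integral>\<^sup>+ x. g x \<partial>lborel)"
    if [measurable]: "g \<in> borel_measurable borel" for g :: "'a \<Rightarrow> ennreal" and a
    by (subst (2) lborel_distr_plus[symmetric, of a]) (simp add: nn_integral_distr)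
  have "emeasure lborel (f -` A) * \<beta> = (\<integral>\<^sup>+ x. \<integral>\<^sup>+ y. indicator A (f x) * indicator B (f x - y) \<partial>lborel \<partial>lborel)"
  proof -
    have "(\<integral>\<^sup>+ y. indicator B (f x - y) \<partial>lborel) = \<beta>" for x
    proof -
      have "(\<integral>\<^sup>+ y. indicator B (f x - y) \<partial>lborel) = (\<integral>\<^sup>+ y. indicator B (- f x + y) \<partial>lborel)"
        using B(2)[of "f x - _"] by (intro nn_integral_cong) (simp add: indicator_def add.commute)
      also have "\<dots> = (\<integral>\<^sup>+ y. indicator B y \<partial>lborel)" by (rule shift) simp
      finally show ?thesis by (simp add: \<beta>_def)
    qed
    then have "(\<integral>\<^sup>+ x. \<integral>\<^sup>+ y. indicator A (f x) * indicator B (f x - y) \<partial>lborel \<partial>lborel)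
      = (\<integral>\<^sup>+ x. indicator (f -` A) x * \<beta> \<partial>lborel)"
      by (intro nn_integral_cong) (simp add: nn_integral_cmult indicator_def)
    moreover have "f -` A \<in> sets lborel" using measurable_sets[of f borel borel A] by simp
    ultimately show ?thesis by (simp add: nn_integral_multc)
  qed
  also have "\<dots> = (\<integral>\<^sup>+ y. \<integral>\<^sup>+ x. indicator A (f x) * indicator B (f x - y) \<partial>lborel \<partial>lborel)"
    by (rule lborel_pair.Fubini') measurable
  also have "\<dots> = (\<integral>\<^sup>+ y. \<integral>\<^sup>+ x. indicator A (f x + y) * indicator B (f x) \<partial>lborel \<partial>lborel)"
  proof (rule nn_integral_cong)
    fix y :: 'a
    obtain z where z: "f z = y" using orthogonal_transformation_surj[OF f] by (metis surjD)
    show "(\<integral>\<^sup>+ x. indicator A (f x) * indicator B (f x - y) \<partial>lborel) = (\<integral>\<^sup>+ x. indicator A (f x + y) * indicator B (f x) \<partial>lborel)"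
      by (subst shift[of _ z, symmetric]) (auto simp: linear_add[OF lin] z add.commute)
  qed
  also have "\<dots> = (\<integral>\<^sup>+ x. \<integral>\<^sup>+ y. indicator A (f x + y) * indicator B (f x) \<partial>lborel \<partial>lborel)"
    by (rule lborel_pair.Fubini') measurable
  also have "\<dots> = (\<integral>\<^sup>+ x. emeasure lborel A * indicator B x \<partial>lborel)"
  proof (rule nn_integral_cong)
    fix x
    have "(\<integral>\<^sup>+ y. indicator A (f x + y) \<partial>lborel) = emeasure lborel A"
      by (subst shift) simp_all
    then show "(\<integral>\<^sup>+ y. indicator A (f x + y) * indicator B (f x) \<partial>lborel) = emeasure lborel A * indicator B x"
      using B(1)[of x] by (simp add: nn_integral_multc indicator_def)
  qed
  also have "\<dots> = emeasure lborel A * \<beta>"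
    by (simp add: nn_integral_cmult \<beta>_def)
  finally have "emeasure lborel (f -` A) = emeasure lborel A"
    using \<beta> by (metis mult_divide_eq_ennreal infinity_ennreal_def)
  then show "emeasure (distr lborel borel f) A = emeasure lborel A"
    by (simp add: emeasure_distr)
qed simp

text \<open>An orthogonal map preserves the unit ball and commutes with the radial projection, so
  the invariance of Lebesgue measure passes to the cone measure.\<close>

lemma distr_sphere_measure_orthogonal_transformation:
  fixes f :: "'a::euclidean_space \<Rightarrow> 'a"
  assumes f: "orthogonal_transformation f"
  shows "distr (sphere_measure r) borel f = sphere_measure r"
proof -
  have lin: "linear f" using f by (simp add: orthogonal_transformation_linear)
  have [measurable]: "f \<in> borel_measurable borel"
    using lin by (simp add: borel_measurable_continuous_onI linear_continuous_on linear_linear)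
  let ?B = "ball (0::'a) 1" and ?P = "\<lambda>x::'a. r *\<^sub>R sgn x"
  have B: "?B \<inter> f -` A = f -` (?B \<inter> A)" for A
    using orthogonal_transformation_norm[OF f] by auto
  have ball: "distr (uniform_measure lborel ?B) borel f = uniform_measure lborel ?B"
  proof (rule measure_eqI)
    fix A assume "A \<in> sets (distr (uniform_measure lborel ?B) borel f)"
    then have [measurable]: "A \<in> sets borel" by simp
    have "emeasure lborel (?B \<inter> f -` A) = emeasure (distr lborel borel f) (?B \<inter> A)"
      unfolding B by (subst emeasure_distr) auto
    then show "emeasure (distr (uniform_measure lborel ?B) borel f) A = emeasure (uniform_measure lborel ?B) A"
      using measurable_sets[of f borel borel A]
      by (simp add: emeasure_distr space_uniform_measure distr_lborel_orthogonal_transformation[OF f])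
  qed simp
  have comm: "f \<circ> ?P = ?P \<circ> f"
    using orthogonal_transformation_norm[OF f]
    by (auto simp: sgn_div_norm linear_scale[OF lin])
  have "distr (sphere_measure r) borel f = distr (uniform_measure lborel ?B) borel (f \<circ> ?P)"
    unfolding sphere_measure_def by (subst distr_distr) simp_all
  also have "\<dots> = distr (distr (uniform_measure lborel ?B) borel f) borel ?P"
    unfolding comm by (subst distr_distr) simp_all
  also have "\<dots> = sphere_measure r"
    by (simp add: ball sphere_measure_def)
  finally show ?thesis .
qed

lemma integral_sphere_measure_inner_power:
  fixes a b :: "real ^ 'n"
  assumes "norm a = norm b"
  shows "(LINT x|sphere_measure r. (x \<bullet> a) ^ k) = (LINT x|sphere_measure r. (x \<bullet> b) ^ k)"
proof -
  obtain f where f: "orthogonal_transformation f" "f a = b"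
    using orthogonal_transformation_exists[OF assms] by metis
  have lin: "linear f" using f by (simp add: orthogonal_transformation_linear)
  have [measurable]: "f \<in> borel_measurable borel"
    using lin by (simp add: borel_measurable_continuous_onI linear_continuous_on linear_linear)
  have "(LINT x|sphere_measure r. (x \<bullet> b) ^ k) = (LINT x|distr (sphere_measure r) borel f. (x \<bullet> b) ^ k)"
    by (simp add: distr_sphere_measure_orthogonal_transformation[OF f(1)])
  also have "\<dots> = (LINT x|sphere_measure r. (f x \<bullet> f a) ^ k)"
    unfolding f(2) by (subst integral_distr) (simp_all add: sphere_measure_def)
  also have "\<dots> = (LINT x|sphere_measure r. (x \<bullet> a) ^ k)"
    using f(1) by (simp add: orthogonal_transformation_def)
  finally show ?thesis by simp
qed

section \<open>Powers of linear forms as polynomials\<close>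

lemma polynomial_of_degree_le_sum:
  assumes "\<And>i. i \<in> I \<Longrightarrow> polynomial_of_degree_le t (f i)"
  shows "polynomial_of_degree_le t (\<lambda>x. \<Sum>i\<in>I. k i * f i x)"
proof -
  have "\<forall>i. \<exists>c. i \<in> I \<longrightarrow> (\<forall>x. f i x = (\<Sum>\<alpha> | sum \<alpha> UNIV \<le> t. c \<alpha> * (\<Prod>j\<in>UNIV. (x $ j) ^ \<alpha> j)))"
    using assms unfolding polynomial_of_degree_le_def by metis
  then obtain c where c: "\<And>i x. i \<in> I \<Longrightarrow> f i x = (\<Sum>\<alpha> | sum \<alpha> UNIV \<le> t. c i \<alpha> * (\<Prod>j\<in>UNIV. (x $ j) ^ \<alpha> j))"
    by metis
  show ?thesis
    unfolding polynomial_of_degree_le_def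
  proof (intro exI allI)
    fix x
    have "(\<Sum>i\<in>I. k i * f i x) = (\<Sum>i\<in>I. \<Sum>\<alpha> | sum \<alpha> UNIV \<le> t. k i * c i \<alpha> * (\<Prod>j\<in>UNIV. (x $ j) ^ \<alpha> j))"
      by (intro sum.cong) (simp_all add: c sum_distrib_left mult.assoc)
    also have "\<dots> = (\<Sum>\<alpha> | sum \<alpha> UNIV \<le> t. \<Sum>i\<in>I. k i * c i \<alpha> * (\<Prod>j\<in>UNIV. (x $ j) ^ \<alpha> j))"
      by (rule sum.swap)
    also have "\<dots> = (\<Sum>\<alpha> | sum \<alpha> UNIV \<le> t. (\<Sum>i\<in>I. k i * c i \<alpha>) * (\<Prod>j\<in>UNIV. (x $ j) ^ \<alpha> j))"
      by (simp only: sum_distrib_right)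
    finally show "(\<Sum>i\<in>I. k i * f i x) = (\<Sum>\<alpha> | sum \<alpha> UNIV \<le> t. (\<Sum>i\<in>I. k i * c i \<alpha>) * (\<Prod>j\<in>UNIV. (x $ j) ^ \<alpha> j))" .
  qed
qed

lemma polynomial_of_degree_le_component_mult:
  fixes f :: "real ^ 'n \<Rightarrow> real"
  assumes "polynomial_of_degree_le t f"
  shows "polynomial_of_degree_le (Suc t) (\<lambda>x. x $ i * f x)"
proof -
  obtain c where c: "\<And>x. f x = (\<Sum>\<alpha> | sum \<alpha> UNIV \<le> t. c \<alpha> * (\<Prod>j\<in>UNIV. (x $ j) ^ \<alpha> j))"
    using assms unfolding polynomial_of_degree_le_def by metis
  define up :: "('n \<Rightarrow> nat) \<Rightarrow> 'n \<Rightarrow> nat" where "up \<alpha> = \<alpha>(i := Suc (\<alpha> i))" for \<alpha>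
  define dn :: "('n \<Rightarrow> nat) \<Rightarrow> 'n \<Rightarrow> nat" where "dn \<alpha> = \<alpha>(i := \<alpha> i - 1)" for \<alpha>
  have dn_up: "dn (up \<alpha>) = \<alpha>" for \<alpha> by (simp add: up_def dn_def)
  have sum_up: "sum (up \<alpha>) UNIV = Suc (sum \<alpha> UNIV)" for \<alpha>
    by (simp add: sum.remove[of UNIV i] up_def)
  have prod_up: "(\<Prod>j\<in>UNIV. (x $ j) ^ up \<alpha> j) = x $ i * (\<Prod>j\<in>UNIV. (x $ j) ^ \<alpha> j)" for x :: "real ^ 'n" and \<alpha>
    by (simp add: prod.remove[of UNIV i] up_def)
  show ?thesis
    unfolding polynomial_of_degree_le_def
  proof (intro exI allI)
    fix x :: "real ^ 'n"
    \<comment> \<open>Coefficients vanish off the image of \<open>up\<close>, so the shifted sum can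
      be enlarged to all exponents of degree at most \<open>Suc t\<close>.\<close>
    let ?c = "\<lambda>\<alpha>. if \<alpha> \<in> range up then c (dn \<alpha>) else 0"
    have "x $ i * f x = (\<Sum>\<alpha> | sum \<alpha> UNIV \<le> t. ?c (up \<alpha>) * (\<Prod>j\<in>UNIV. (x $ j) ^ up \<alpha> j))"
      unfolding c sum_distrib_left by (simp add: dn_up prod_up mult_ac)
    also have "\<dots> = (\<Sum>\<alpha>\<in>up ` {\<alpha>. sum \<alpha> UNIV \<le> t}. ?c \<alpha> * (\<Prod>j\<in>UNIV. (x $ j) ^ \<alpha> j))"
      by (subst sum.reindex) (auto intro: inj_on_inverseI dn_up)
    also have "\<dots> = (\<Sum>\<alpha> | sum \<alpha> UNIV \<le> Suc t. ?c \<alpha> * (\<Prod>j\<in>UNIV. (x $ j) ^ \<alpha> j))"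
      by (rule sum.mono_neutral_left) (auto simp: sum_up finite_exponents_degree_le)
    finally show "x $ i * f x = (\<Sum>\<alpha> | sum \<alpha> UNIV \<le> Suc t. ?c \<alpha> * (\<Prod>j\<in>UNIV. (x $ j) ^ \<alpha> j))" .
  qed
qed

lemma polynomial_of_degree_le_const_1:
  "polynomial_of_degree_le t (\<lambda>_ :: real ^ 'n. 1)"
  unfolding polynomial_of_degree_le_def
proof (intro exI allI)
  fix x :: "real ^ 'n"
  let ?c = "\<lambda>\<alpha> :: 'n \<Rightarrow> nat. if \<alpha> = (\<lambda>_. 0) then 1 else 0 :: real"
  have "(\<Sum>\<alpha> | sum \<alpha> UNIV \<le> t. ?c \<alpha> * (\<Prod>j\<in>UNIV. (x $ j) ^ \<alpha> j)) = (\<Sum>\<alpha> \<in> {\<lambda>_. 0}. ?c \<alpha> * (\<Prod>j\<in>UNIV. (x $ j) ^ \<alpha> j))"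
    by (rule sum.mono_neutral_right) (auto simp: finite_exponents_degree_le)
  then show "1 = (\<Sum>\<alpha> | sum \<alpha> UNIV \<le> t. ?c \<alpha> * (\<Prod>j\<in>UNIV. (x $ j) ^ \<alpha> j))" by simp
qed

lemma polynomial_of_degree_le_inner_power:
  fixes a :: "real ^ 'n"
  assumes "k \<le> t"
  shows "polynomial_of_degree_le t (\<lambda>x. (x \<bullet> a) ^ k)"
  using assms
proof (induction k arbitrary: t)
  case 0
  then show ?case by (simp add: polynomial_of_degree_le_const_1)
next
  case (Suc k)
  then obtain t' where t: "t = Suc t'" "k \<le> t'" by (cases t) auto
  have "polynomial_of_degree_le t (\<lambda>x. \<Sum>i\<in>UNIV. a $ i * (x $ i * (x \<bullet> a) ^ k))"
    unfolding t by (intro polynomial_of_degree_le_sum polynomial_of_degree_le_component_mult Suc.IH t)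
  then show ?case by (simp add: inner_vec_def sum_distrib_right mult_ac)
qed

section \<open>Second and fourth moments from coordinate vectors\<close>

lemma axis_nth_if: "axis i x $ j = (if j = i then x else 0)"
  by (simp add: axis_def)

lemma norm_axis: "norm (axis i (x::real)) = \<bar>x\<bar>"
  by (simp add: norm_eq_sqrt_inner inner_axis axis_nth_if)

text \<open>Both averages equal the same rotation invariant integral. This takes the place of
  explicit values of spherical moments.\<close>

lemma spherical_design_sum_power:
  fixes Y :: "(real ^ 'n) set"
  assumes Y: "spherical_design t r Y" and k: "k \<le> t" and "norm a = norm b"
  shows "(\<Sum>y\<in>Y. (y \<bullet> a) ^ k) = (\<Sum>y\<in>Y. (y \<bullet> b) ^ k)"
proof -
  have "(\<Sum>y\<in>Y. (y \<bullet> a) ^ k) / real (card Y) = (\<Sum>y\<in>Y. (y \<bullet> b) ^ k) / real (card Y)"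
    using Y polynomial_of_degree_le_inner_power[OF k] integral_sphere_measure_inner_power[OF assms(3), of r k]
    unfolding spherical_design_def by metis
  moreover have "finite Y" using Y by (simp add: spherical_design_def)
  ultimately show ?thesis by (cases "Y = {}") auto
qed

text \<open>The direction \<open>a\<close> may be replaced by \<open>norm a\<close> times any
  coordinate vector; summing over the coordinates leaves \<open>(y, y) = r^2\<close> for each
  \<open>y\<close>.\<close>

lemma spherical_design_second_moment:
  fixes Y :: "(real ^ 'n) set"
  assumes Y: "spherical_design t r Y" and t: "2 \<le> t"
  shows "real CARD('n) * (\<Sum>y\<in>Y. (y \<bullet> a)\<^sup>2) = real (card Y) * r\<^sup>2 * (a \<bullet> a)"
proof -
  define F where "F a = (\<Sum>y\<in>Y. (y \<bullet> a)\<^sup>2)" for a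
  have F: "F a = F b" if "norm a = norm b" for a b
    using spherical_design_sum_power[OF Y t that] by (simp add: F_def)
  have Fa: "F (axis i (norm a)) = F a" for i by (rule F) (simp add: norm_axis)
  have "real CARD('n) * F a = (\<Sum>i\<in>UNIV. F (axis i (norm a)))"
    by (simp add: Fa)
  also have "\<dots> = (\<Sum>i\<in>UNIV. \<Sum>y\<in>Y. (a \<bullet> a) * (y $ i)\<^sup>2)"
    by (simp add: F_def inner_axis power_mult_distrib power2_norm_eq_inner mult.commute)
  also have "\<dots> = (\<Sum>y\<in>Y. \<Sum>i\<in>UNIV. (a \<bullet> a) * (y $ i)\<^sup>2)"
    by (rule sum.swap)
  also have "\<dots> = (\<Sum>y\<in>Y. (a \<bullet> a) * r\<^sup>2)"
  proof (intro sum.cong refl)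
    fix y assume "y \<in> Y"
    then have "norm y = r" using Y by (auto simp: spherical_design_def)
    moreover have "(\<Sum>i\<in>UNIV. (y $ i)\<^sup>2) = (norm y)\<^sup>2"
      unfolding power2_norm_eq_inner by (simp add: inner_vec_def power2_eq_square)
    ultimately show "(\<Sum>i\<in>UNIV. (a \<bullet> a) * (y $ i)\<^sup>2) = (a \<bullet> a) * r\<^sup>2"
      by (simp flip: sum_distrib_left)
  qed
  finally show ?thesis by (simp add: F_def mult_ac)
qed

text \<open>The unknowns are the coordinate sums \<open>G i j\<close>. Directions along one axis
  make all \<open>G i i\<close> equal to a common \<open>p\<close>, diagonal directions in a
  coordinate plane give \<open>3 * G i j = p\<close>, and summing \<open>(y, y)^2 = r^4\<close> over
  the design determines \<open>p\<close>.\<close>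

lemma spherical_design_fourth_moment:
  fixes Y :: "(real ^ 'n) set"
  assumes Y: "spherical_design t r Y" and t: "4 \<le> t"
  shows "real CARD('n) * (real CARD('n) + 2) * (\<Sum>y\<in>Y. (y \<bullet> a) ^ 4) = 3 * real (card Y) * r ^ 4 * (a \<bullet> a)\<^sup>2"
proof -
  define F where "F a = (\<Sum>y\<in>Y. (y \<bullet> a) ^ 4)" for a
  define G where "G i j = (\<Sum>y\<in>Y. (y $ i)\<^sup>2 * (y $ j)\<^sup>2)" for i j
  have F: "F a = F b" if "norm a = norm b" for a b
    using spherical_design_sum_power[OF Y t that] by (simp add: F_def)
  have F_scale: "F (c *\<^sub>R a) = c ^ 4 * F a" for c a
    by (simp add: F_def power_mult_distrib sum_distrib_left)
  define p where "p = F (axis undefined 1)"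
  have F_axis: "F (axis i 1) = p" for i
    unfolding p_def by (rule F) (simp add: norm_axis)
  have Fp: "F a = (a \<bullet> a)\<^sup>2 * p" for a
  proof -
    have "F a = F (norm a *\<^sub>R axis undefined 1)" by (rule F) (simp add: norm_axis)
    also have "\<dots> = (norm a ^ 2) ^ 2 * p" by (simp add: F_scale p_def flip: power_mult)
    finally show ?thesis by (simp only: power2_norm_eq_inner)
  qed
  have G_diag: "G i i = p" for i
    using F_axis[of i] by (simp add: F_def G_def inner_axis power4_eq_xxxx power2_eq_square mult.assoc)
  text \<open>The identity \<open>(s + t)^4 + (s - t)^4 = 2 s^4 + 12 s^2 t^2 + 2 t^4\<close> on the coordinates \<open>i\<close>, \<open>j\<close>.\<close>
  have G_off: "3 * G i j = p" if "i \<noteq> j" for i j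
  proof -
    have "F (axis i 1 + axis j 1) + F (axis i 1 - axis j 1) = 2 * G i i + 12 * G i j + 2 * G j j"
      unfolding F_def G_def sum_distrib_left sum.distrib[symmetric]
      by (intro sum.cong refl) (simp add: inner_axis inner_add_right inner_diff_right power4_eq_xxxx power2_eq_square algebra_simps)
    moreover have "(axis i 1 + axis j 1) \<bullet> (axis i 1 + axis j (1::real)) = 2"
      "(axis i 1 - axis j 1) \<bullet> (axis i 1 - axis j (1::real)) = 2"
      using that by (simp_all add: inner_axis axis_nth_if inner_add_right inner_diff_right)
    ultimately show ?thesis unfolding Fp G_diag by simp
  qed
  have "real (card Y) * r ^ 4 = (\<Sum>y\<in>Y. (\<Sum>i\<in>UNIV. (y $ i)\<^sup>2) * (\<Sum>j\<in>UNIV. (y $ j)\<^sup>2))"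
  proof -
    have "(\<Sum>i\<in>UNIV. (y $ i)\<^sup>2) = r\<^sup>2" if "y \<in> Y" for y
    proof -
      have "norm y = r" using Y that by (auto simp: spherical_design_def)
      then show ?thesis
        by (simp add: norm_eq_square inner_vec_def power2_eq_square)
    qed
    then show ?thesis by (simp add: power4_eq_xxxx power2_eq_square mult.assoc)
  qed
  also have "\<dots> = (\<Sum>i\<in>UNIV. \<Sum>j\<in>UNIV. G i j)"
    unfolding sum_product G_def
    by (subst sum.swap) (intro sum.cong refl sum.swap)
  also have "\<dots> = (\<Sum>i\<in>(UNIV :: 'n set). \<Sum>j\<in>UNIV. p / 3 + (if i = j then 2 * p / 3 else 0))"
  proof -
    have "G i j = p / 3 + (if i = j then 2 * p / 3 else 0)" for i j
      using G_off[of i j] by (cases "i = j") (simp_all add: G_diag)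
    then show ?thesis by simp
  qed
  also have "\<dots> = real CARD('n) * (real CARD('n) + 2) * p / 3"
    by (simp add: sum.distrib) (simp add: field_simps)
  finally have "real CARD('n) * (real CARD('n) + 2) * p = 3 * real (card Y) * r ^ 4" by simp
  moreover have "real CARD('n) * (real CARD('n) + 2) * F a = real CARD('n) * (real CARD('n) + 2) * p * (a \<bullet> a)\<^sup>2"
    by (simp only: Fp mult_ac)
  ultimately show ?thesis unfolding F_def by simp
qed

lemma sum_antipodal:
  fixes f :: "'a::real_vector \<Rightarrow> real"
  assumes "finite X" "X \<inter> uminus ` X = {}" "\<And>x. f (- x) = f x"
  shows "(\<Sum>x\<in>X \<union> uminus ` X. f x) = 2 * (\<Sum>x\<in>X. f x)"
proof -
  have "(\<Sum>x\<in>uminus ` X. f x) = (\<Sum>x\<in>X. f x)"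
    by (subst sum.reindex) (auto simp: assms(3))
  then show ?thesis using assms by (simp add: sum.union_disjoint)
qed

text \<open>With \<open>q = m (m + 1)\<close> one has \<open>n = 4 q - 1\<close>,
  \<open>d^2 = n + 2 = 4 q + 1\<close> and \<open>n (n + 1)\<close> points, so the factors
  \<open>n\<close> and \<open>n + 2\<close> of the moment identities cancel. Passing from the
  antipodal set to \<open>X\<close> halves every even power sum.\<close>

lemma tight_5_design_half:
  fixes X :: "(real ^ 'n) set"
  assumes m: "m \<ge> 1" "d = 2 * m + 1" "CARD('n) = d\<^sup>2 - 2"
    and X: "X \<inter> uminus ` X = {}" "tight_spherical_5_design (sqrt (real d)) (X \<union> uminus ` X)"
  shows tight_5_design_dim: "CARD('n) + 1 = 4 * (m * (m + 1))"
    and tight_5_design_finite: "finite X"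
    and tight_5_design_card: "real (card X) = (4 * (real m * (real m + 1)) - 1) * (2 * (real m * (real m + 1)))"
    and tight_5_design_moment2: "(\<Sum>x\<in>X. (x \<bullet> a)\<^sup>2) = 2 * (real m * (real m + 1)) * real d * (a \<bullet> a)"
    and tight_5_design_moment4: "(\<Sum>x\<in>X. (x \<bullet> a) ^ 4) = 6 * (real m * (real m + 1)) * (a \<bullet> a)\<^sup>2"
proof -
  let ?Y = "X \<union> uminus ` X"
  have d2: "d\<^sup>2 = 4 * (m * (m + 1)) + 1"
    by (simp add: m(2) power2_eq_square algebra_simps)
  have "m * (m + 1) \<ge> 1" using m(1) by simp
  then show dim: "CARD('n) + 1 = 4 * (m * (m + 1))" using d2 m(3) by simp
  define q where "q = real m * (real m + 1)"
  have q: "q > 0" using m(1) by (simp add: q_def)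
  have n: "real CARD('n) = 4 * q - 1"
  proof -
    have "real (CARD('n) + 1) = real (4 * (m * (m + 1)))" using dim by (simp only:)
    then show ?thesis by (simp add: q_def algebra_simps)
  qed
  have dq: "(real d)\<^sup>2 = 4 * q + 1"
    using arg_cong[OF d2, of real] by (simp add: q_def algebra_simps)
  have Y: "spherical_design 5 (sqrt (real d)) ?Y" "card ?Y = 2 * ((CARD('n) + 1) choose 2)"
    using X(2) by (auto simp: tight_spherical_5_design_def)
  show fin: "finite X" using Y(1) by (simp add: spherical_design_def)
  have "card ?Y = CARD('n) * (CARD('n) + 1)"
    unfolding Y(2) choose_two by simp
  then have cardY: "real (card ?Y) = (4 * q - 1) * (4 * q)"
    by (simp add: n algebra_simps)
  have "real (card ?Y) = 2 * real (card X)"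
    using sum_antipodal[OF fin X(1), of "\<lambda>_. 1"] by simp
  then show "real (card X) = (4 * (real m * (real m + 1)) - 1) * (2 * (real m * (real m + 1)))"
    using cardY unfolding q_def[symmetric] by (simp add: algebra_simps)
  have "real CARD('n) > 0" by simp
  then have n0: "4 * q - 1 \<noteq> 0" using n by linarith
  have "(4 * q - 1) * (2 * (\<Sum>x\<in>X. (x \<bullet> a)\<^sup>2)) = (4 * q - 1) * (4 * q * real d * (a \<bullet> a))"
    using spherical_design_second_moment[OF Y(1), of a] sum_antipodal[OF fin X(1), of "\<lambda>x. (x \<bullet> a)\<^sup>2"]
    unfolding n cardY by (simp add: mult_ac)
  then show "(\<Sum>x\<in>X. (x \<bullet> a)\<^sup>2) = 2 * (real m * (real m + 1)) * real d * (a \<bullet> a)"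
    using n0 by (simp add: q_def)
  have "sqrt (real d) ^ 4 = (real d)\<^sup>2"
    by (simp add: power4_eq_xxxx power2_eq_square)
  then have "(4 * q - 1) * (4 * q - 1 + 2) * (2 * (\<Sum>x\<in>X. (x \<bullet> a) ^ 4)) = 3 * ((4 * q - 1) * (4 * q)) * (4 * q + 1) * (a \<bullet> a)\<^sup>2"
    using spherical_design_fourth_moment[OF Y(1), of a] sum_antipodal[OF fin X(1), of "\<lambda>x. (x \<bullet> a) ^ 4"]
    unfolding n cardY dq by simp
  then have "((4 * q - 1) * (4 * q + 1)) * (2 * (\<Sum>x\<in>X. (x \<bullet> a) ^ 4)) = ((4 * q - 1) * (4 * q + 1)) * (12 * q * (a \<bullet> a)\<^sup>2)"
    by (simp add: algebra_simps)
  then have "2 * (\<Sum>x\<in>X. (x \<bullet> a) ^ 4) = 12 * q * (a \<bullet> a)\<^sup>2"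
    using n0 q unfolding mult_cancel_left by simp
  then show "(\<Sum>x\<in>X. (x \<bullet> a) ^ 4) = 6 * (real m * (real m + 1)) * (a \<bullet> a)\<^sup>2"
    by (simp add: q_def)
qed

text \<open>By the moment identities the nonnegative sum of \<open>((y, x)^2 - 1)^2\<close> over \<open>y \<noteq> x\<close> vanishes.\<close>

lemma tight_5_design_inner:
  fixes X :: "(real ^ 'n) set"
  assumes m: "m \<ge> 1" "d = 2 * m + 1" "CARD('n) = d\<^sup>2 - 2"
    and X: "X \<inter> uminus ` X = {}" "tight_spherical_5_design (sqrt (real d)) (X \<union> uminus ` X)"
    and x: "x \<in> X" "x \<bullet> x = real d" and y: "y \<in> X" "y \<noteq> x"
  shows "y \<bullet> x = 1 \<or> y \<bullet> x = - 1"
proof -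
  define q where "q = real m * (real m + 1)"
  note half = tight_5_design_half[OF m X, folded q_def]
  have dq: "(real d)\<^sup>2 = 4 * q + 1"
    by (simp add: m(2) q_def power2_eq_square algebra_simps)
  have expand: "((z \<bullet> x)\<^sup>2 - 1)\<^sup>2 = (z \<bullet> x) ^ 4 - 2 * (z \<bullet> x)\<^sup>2 + 1" for z
    by (simp add: power2_eq_square power4_eq_xxxx algebra_simps)
  have "(\<Sum>z\<in>X. ((z \<bullet> x)\<^sup>2 - 1)\<^sup>2) = (\<Sum>z\<in>X. (z \<bullet> x) ^ 4) - 2 * (\<Sum>z\<in>X. (z \<bullet> x)\<^sup>2) + real (card X)"
    by (simp add: expand sum.distrib sum_subtractf sum_distrib_left)
  also have "\<dots> = 6 * q * (real d)\<^sup>2 - 4 * q * (real d)\<^sup>2 + (4 * q - 1) * (2 * q)"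
    unfolding half(3,4,5) x(2) by (simp add: power2_eq_square)
  \<comment> \<open>By \<open>d^2 = 4 q + 1\<close> the total is \<open>16 q^2\<close>, which is
    already the single term \<open>z = x\<close>.\<close>
  also have "\<dots> = ((real d)\<^sup>2 - 1)\<^sup>2"
    unfolding dq by (simp add: power2_eq_square algebra_simps)
  also have "(\<Sum>z\<in>X. ((z \<bullet> x)\<^sup>2 - 1)\<^sup>2) = ((real d)\<^sup>2 - 1)\<^sup>2 + (\<Sum>z\<in>X - {x}. ((z \<bullet> x)\<^sup>2 - 1)\<^sup>2)"
    using half(2) x by (simp add: sum.remove)
  finally have "(\<Sum>z\<in>X - {x}. ((z \<bullet> x)\<^sup>2 - 1)\<^sup>2) = 0" by simp
  then have "((y \<bullet> x)\<^sup>2 - 1)\<^sup>2 = 0"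
    using half(2) y by (subst (asm) sum_nonneg_eq_0_iff) auto
  then show ?thesis by (simp add: power2_eq_1_iff)
qed

subsection \<open>Quadratic Gauss sums\<close>

text \<open>The q-Pascal recurrence replaces the usual quotient of products: it needs no division,
  so \<open>q\<close> may be a root of unity.\<close>

fun gauss_binomial :: "'a::comm_ring_1 \<Rightarrow> nat \<Rightarrow> nat \<Rightarrow> 'a" where
  "gauss_binomial q m 0 = 1"
| "gauss_binomial q 0 (Suc j) = 0"
| "gauss_binomial q (Suc m) (Suc j) = gauss_binomial q m j + q ^ Suc j * gauss_binomial q m (Suc j)"

lemma gauss_binomial_eq_0: "m < j \<Longrightarrow> gauss_binomial q m j = 0"
proof (induction m arbitrary: j)
  case 0 then show ?case by (cases j) auto
next
  case (Suc m) then show ?case by (cases j) auto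
qed

text \<open>The quotient formula with denominators cleared. The induction rests on
  \<open>(1 - a) + a (1 - b) = 1 - a b\<close> for \<open>a = q ^ Suc i\<close>,
  \<open>b = q ^ Suc l\<close>.\<close>

lemma gauss_binomial_prod:
  fixes q :: "'a::comm_ring_1"
  assumes "j \<le> m"
  shows "gauss_binomial q m j * (\<Prod>i=1..j. 1 - q ^ i) * (\<Prod>i=1..m-j. 1 - q ^ i) = (\<Prod>i=1..m. 1 - q ^ i)"
  using assms
proof (induction m arbitrary: j)
  case 0 then show ?case by simp
next
  case (Suc m)
  let ?P = "\<lambda>k. \<Prod>i=1..k. 1 - q ^ i"
  have PS: "?P (Suc k) = ?P k * (1 - q ^ Suc k)" for k by simp
  show ?case
  proof (cases j)
    case 0 then show ?thesis by simp
  next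
    case (Suc i)
    have i: "i \<le> m" using Suc Suc.prems by simp
    have IH1: "gauss_binomial q m i * ?P i * ?P (m - i) = ?P m"
      using Suc.IH[OF i] .
    show ?thesis
    proof (cases "i = m")
      case True
      then show ?thesis using IH1 Suc by (simp add: gauss_binomial_eq_0 algebra_simps)
    next
      case False
      define l where "l = m - Suc i"
      have m: "m = Suc (i + l)" using False i by (simp add: l_def)
      have IH2: "gauss_binomial q m (Suc i) * ?P (Suc i) * ?P l = ?P m"
        using Suc.IH[of "Suc i"] m by simp
      have IH1': "gauss_binomial q m i * ?P i * ?P (Suc l) = ?P m"
        using IH1 m by simp
      have "gauss_binomial q (Suc m) (Suc i) * ?P (Suc i) * ?P (Suc l)
        = (gauss_binomial q m i * ?P i * ?P (Suc l)) * (1 - q ^ Suc i)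
          + q ^ Suc i * (gauss_binomial q m (Suc i) * ?P (Suc i) * ?P l) * (1 - q ^ Suc l)"
        unfolding gauss_binomial.simps PS by (simp only: algebra_simps)
      also have "\<dots> = ?P m * (1 - q ^ Suc i * q ^ Suc l)"
        unfolding IH1' IH2 by (simp only: algebra_simps mult_1_left mult_1_right)
      also have "q ^ Suc i * q ^ Suc l = q ^ Suc m"
        by (simp add: m power_add)
      finally show ?thesis using Suc m PS[of m] by simp
    qed
  qed
qed

text \<open>The analogue of \<open>(j + 1) C(m + 1, j + 1) = (m + 1) C(m, j)\<close>. The assumption
  on \<open>q\<close> permits cancelling the products left over from
  \<open>gauss_binomial_prod\<close>.\<close>

lemma gauss_binomial_absorb:
  fixes q :: "'a::idom"
  assumes "\<And>i. i \<in> {1..m} \<Longrightarrow> q ^ i \<noteq> 1"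
  shows "(1 - q ^ Suc j) * gauss_binomial q (Suc m) (Suc j) = (1 - q ^ Suc m) * gauss_binomial q m j"
proof (cases "j \<le> m")
  case False then show ?thesis by (simp add: gauss_binomial_eq_0)
next
  case True
  let ?P = "\<lambda>k. \<Prod>i=1..k. 1 - q ^ i"
  have PS: "?P (Suc k) = ?P k * (1 - q ^ Suc k)" for k by simp
  have nz: "?P k \<noteq> 0" if "k \<le> m" for k using assms that by auto
  have 1: "gauss_binomial q (Suc m) (Suc j) * ?P (Suc j) * ?P (m - j) = ?P (Suc m)"
    using gauss_binomial_prod[of "Suc j" "Suc m" q] True by (simp del: gauss_binomial.simps)
  have 2: "gauss_binomial q m j * ?P j * ?P (m - j) = ?P m"
    using gauss_binomial_prod[of j m q] True by simp
  have "((1 - q ^ Suc j) * gauss_binomial q (Suc m) (Suc j)) * (?P j * ?P (m - j))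
      = ((1 - q ^ Suc m) * gauss_binomial q m j) * (?P j * ?P (m - j))"
  proof -
    have aux: "(a * g) * (p * r) = (b * h) * (p * r)" if "g * (p * a) * r = P * b" "h * p * r = P"
      for a b g h p r P :: 'a
      using that by algebra
    show ?thesis using 1 2 unfolding PS by (rule aux)
  qed
  then show ?thesis using nz[of j] nz[of "m - j"] True by simp
qed

text \<open>The three-term recurrence of the Rogers-Szego polynomials. Absorption turns the power
  \<open>q ^ Suc j\<close> in Pascal's rule into the factor \<open>1 - q ^ Suc m\<close>, which is
  independent of \<open>j\<close> and so leaves the sum.\<close>

lemma sum_gauss_binomial_rec:
  fixes q t :: "'a::idom"
  assumes "\<And>i. i \<in> {1..m} \<Longrightarrow> q ^ i \<noteq> 1"
  defines "H \<equiv> \<lambda>m. \<Sum>j\<le>m. t ^ j * gauss_binomial q m j"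
  shows "H (Suc (Suc m)) = (1 + t) * H (Suc m) - t * (1 - q ^ Suc m) * H m"
proof -
  let ?g = "gauss_binomial q"
  have coeff: "?g (Suc (Suc m)) (Suc j) = ?g (Suc m) (Suc j) + ?g (Suc m) j - (1 - q ^ Suc m) * ?g m j" for j
    using gauss_binomial_absorb[of m q j, OF assms(1)] by (simp add: algebra_simps)
  have Hm: "H m = (\<Sum>j\<le>Suc m. t ^ j * ?g m j)"
    by (simp add: H_def gauss_binomial_eq_0)
  have HSm: "H (Suc m) = 1 + (\<Sum>j\<le>Suc m. t ^ Suc j * ?g (Suc m) (Suc j))"
    unfolding H_def by (subst sum.atMost_Suc_shift) (simp add: gauss_binomial_eq_0)
  have "H (Suc (Suc m)) = 1 + (\<Sum>j\<le>Suc m. t ^ Suc j * ?g (Suc (Suc m)) (Suc j))"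
    unfolding H_def by (subst sum.atMost_Suc_shift) simp
  also have "\<dots> = 1 + (\<Sum>j\<le>Suc m. t ^ Suc j * ?g (Suc m) (Suc j)) + t * (\<Sum>j\<le>Suc m. t ^ j * ?g (Suc m) j)
      - t * (1 - q ^ Suc m) * (\<Sum>j\<le>Suc m. t ^ j * ?g m j)"
    unfolding coeff
    by (simp only: sum_distrib_left algebra_simps sum.distrib sum_subtractf power_Suc mult_1)
  also have "\<dots> = H (Suc m) + t * H (Suc m) - t * (1 - q ^ Suc m) * H m"
    unfolding HSm[symmetric] Hm[symmetric] by (simp add: H_def)
  finally show ?thesis by (simp add: algebra_simps)
qed

text \<open>At \<open>t = s\<close>, \<open>q = s^2\<close> the product obeys the same recurrence,
  because \<open>1 - q ^ Suc k\<close> splits as \<open>(1 - s ^ Suc k) (1 + s ^ Suc k)\<close> and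
  \<open>(1 + s) - s (1 - s ^ Suc k) = 1 + s ^ Suc (Suc k)\<close>.\<close>

lemma sum_gauss_binomial_square:
  fixes s :: "'a::idom"
  assumes "\<And>i. i \<in> {1..m} \<Longrightarrow> (s\<^sup>2) ^ i \<noteq> 1"
  shows "(\<Sum>j\<le>m. s ^ j * gauss_binomial (s\<^sup>2) m j) = (\<Prod>j=1..m. 1 + s ^ j)"
  using assms
proof (induction m rule: less_induct)
  case (less m)
  consider "m = 0" | "m = 1" | k where "m = Suc (Suc k)"
    by (metis One_nat_def not0_implies_Suc)
  then show ?case
  proof cases
    case 3
    have "(\<Sum>j\<le>m. s ^ j * gauss_binomial (s\<^sup>2) m j)
      = (1 + s) * (\<Prod>j=1..Suc k. 1 + s ^ j) - s * (1 - (s\<^sup>2) ^ Suc k) * (\<Prod>j=1..k. 1 + s ^ j)"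
      unfolding 3 using less.prems 3 less.IH[of "Suc k"] less.IH[of k]
      by (subst sum_gauss_binomial_rec) (auto simp del: power_Suc sum.atMost_Suc gauss_binomial.simps)
    also have "(s\<^sup>2) ^ Suc k = s ^ Suc k * s ^ Suc k"
      by (simp add: power2_eq_square power_mult_distrib)
    also have "(1 + s) * (\<Prod>j=1..Suc k. 1 + s ^ j) - s * (1 - s ^ Suc k * s ^ Suc k) * (\<Prod>j=1..k. 1 + s ^ j)
      = (\<Prod>j=1..k. 1 + s ^ j) * (1 + s ^ Suc k) * (1 + s ^ Suc (Suc k))"
      by (simp add: algebra_simps)
    also have "\<dots> = (\<Prod>j=1..m. 1 + s ^ j)"
      unfolding 3 by simp
    finally show ?thesis .
  qed auto
qed

text \<open>Since \<open>q ^ (N - i)\<close> is the inverse of \<open>q ^ i\<close>, each quotient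
  \<open>(1 - q ^ (N - i)) / (1 - q ^ i)\<close> is minus the inverse of \<open>q ^ i\<close>. The
  power of \<open>q\<close> stands on the left to avoid inverses.\<close>

lemma gauss_binomial_root_of_unity:
  fixes q :: "'a::field"
  assumes "q ^ N = 1" "\<And>i. i \<in> {1..<N} \<Longrightarrow> q ^ i \<noteq> 1" "j < N"
  shows "gauss_binomial q (N - 1) j * q ^ (j * (j + 1) div 2) = (- 1) ^ j"
  using assms(3)
proof (induction j)
  case 0 then show ?case by simp
next
  case (Suc j)
  let ?g = "gauss_binomial q (N - 1)"
  let ?P = "\<lambda>k. \<Prod>i=1..k. 1 - q ^ i"
  have PS: "?P (Suc k) = ?P k * (1 - q ^ Suc k)" for k by simp
  have nz: "?P k \<noteq> 0" if "k < N" for k using assms(2) that by auto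
  define l where "l = N - 2 - j"
  have l: "N - 1 - j = Suc l" "N - 1 - Suc j = l" "Suc l + Suc j = N"
    using Suc.prems by (auto simp: l_def)
  have "?g (Suc j) * (?P j * (1 - q ^ Suc j)) * ?P l = ?g j * ?P j * (?P l * (1 - q ^ Suc l))"
    using gauss_binomial_prod[of j "N - 1" q] gauss_binomial_prod[of "Suc j" "N - 1" q] Suc.prems
    unfolding l PS by simp
  then have "?g (Suc j) * (1 - q ^ Suc j) = ?g j * (1 - q ^ Suc l)"
    using nz[of j] nz[of l] l Suc.prems by simp
  moreover have "q ^ Suc l * q ^ Suc j = 1"
    using assms(1) l(3) by (metis power_add)
  ultimately have "(?g (Suc j) * q ^ Suc j) * (1 - q ^ Suc j) = - ?g j * (1 - q ^ Suc j)"
  proof -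
    have aux: "(h * a) * (1 - a) = - g * (1 - a)" if "h * (1 - a) = g * (1 - b)" "b * a = 1" for a b g h :: 'a
      using that by algebra
    show ?thesis using \<open>?g (Suc j) * (1 - q ^ Suc j) = _\<close> \<open>q ^ Suc l * q ^ Suc j = 1\<close> by (rule aux)
  qed
  moreover have "q ^ Suc j \<noteq> 1" using assms(2)[of "Suc j"] Suc.prems by simp
  ultimately have step: "?g (Suc j) * q ^ Suc j = - ?g j"
    by (metis mult_right_cancel right_minus_eq)
  have "Suc j * (Suc j + 1) div 2 = Suc j + j * (j + 1) div 2" by simp
  then have "?g (Suc j) * q ^ (Suc j * (Suc j + 1) div 2) = (?g (Suc j) * q ^ Suc j) * q ^ (j * (j + 1) div 2)"
    by (simp add: power_add)
  also have "\<dots> = - (?g j * q ^ (j * (j + 1) div 2))"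
    unfolding step by simp
  also have "\<dots> = (- 1) ^ Suc j"
    using Suc by simp
  finally show ?case .
qed

text \<open>With this \<open>s\<close> and \<open>m = N - 1\<close>, the term \<open>s^j [m, j]\<close> at \<open>q = s^2\<close> is the \<open>j\<close>-th term of the Gauss sum.\<close>

lemma gauss_sum_prod:
  assumes "even N" "N > 0"
  defines "s \<equiv> - cis (- pi / real N)"
  shows "(\<Sum>j<N. cis (pi * (real j)\<^sup>2 / real N)) = (\<Prod>j=1..N-1. 1 + s ^ j)"
proof -
  have s2: "s\<^sup>2 = cis (- 2 * pi / real N)"
    by (simp add: s_def power2_eq_square cis_mult)
  have powN: "(s\<^sup>2) ^ N = 1"
  proof -
    have "real N * (- 2 * pi / real N) = - (2 * pi)" using assms by simp
    then have "(s\<^sup>2) ^ N = cis (- (2 * pi))" by (simp only: s2 Complex.DeMoivre)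
    then show ?thesis by (simp add: complex_eq_iff)
  qed
  have ne1: "(s\<^sup>2) ^ i \<noteq> 1" if "i \<in> {1..<N}" for i
  proof
    assume "(s\<^sup>2) ^ i = 1"
    then have "cos (2 * pi * (real i / real N)) = 1"
      unfolding s2 Complex.DeMoivre by (simp add: complex_eq_iff mult_ac)
    then obtain k :: int where "2 * pi * (real i / real N) = of_int k * 2 * pi"
      unfolding cos_one_2pi_int by blast
    then have "pi * (2 * (real i / real N)) = pi * (2 * of_int k)" by (simp add: mult_ac)
    then have "real i / real N = of_int k" unfolding mult_cancel_left by simp
    then have "of_int k > (0::real)" "of_int k < (1::real)" using that by (auto simp flip: \<open>_ = of_int k\<close>)
    then show False by (metis of_int_0_less_iff of_int_less_1_iff not_less zless_add1_eq add_0 int_one_le_iff_zero_less)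
  qed
  have "s ^ j * gauss_binomial (s\<^sup>2) (N - 1) j = cis (pi * (real j)\<^sup>2 / real N)" if "j < N" for j
  proof -
    have "2 * (j * (j + 1) div 2) = j + j\<^sup>2"
      by (simp add: power2_eq_square)
    then have "(s\<^sup>2) ^ (j * (j + 1) div 2) = s ^ j * s ^ (j\<^sup>2)"
      by (metis power_mult power_add)
    then have "gauss_binomial (s\<^sup>2) (N - 1) j * (s ^ j * s ^ (j\<^sup>2)) = (- 1) ^ j"
      using gauss_binomial_root_of_unity[OF powN ne1 that] by simp
    \<comment> \<open>The minus sign in \<open>s\<close> produces exactly \<open>(-1) ^ j\<close>,
      because \<open>j^2\<close> and \<open>j\<close> have the same parity.\<close>
    moreover have "s ^ (j\<^sup>2) * cis (pi * (real j)\<^sup>2 / real N) = (- 1) ^ j"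
      by (simp add: s_def power_minus[of "cis _"] Complex.DeMoivre cis_mult uminus_power_if)
    ultimately have "(s ^ j * gauss_binomial (s\<^sup>2) (N - 1) j) * s ^ (j\<^sup>2)
       = cis (pi * (real j)\<^sup>2 / real N) * s ^ (j\<^sup>2)" by (simp add: mult_ac)
    moreover have "s ^ (j\<^sup>2) \<noteq> 0" by (simp add: s_def)
    ultimately show ?thesis by (metis mult_right_cancel)
  qed
  then have "(\<Sum>j<N. cis (pi * (real j)\<^sup>2 / real N)) = (\<Sum>j\<le>N-1. s ^ j * gauss_binomial (s\<^sup>2) (N - 1) j)"
    using assms(2) by (intro sum.cong) auto
  also have "\<dots> = (\<Prod>j=1..N-1. 1 + s ^ j)"
    using ne1 by (intro sum_gauss_binomial_square) auto
  finally show ?thesis .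
qed

text \<open>Each factor is a positive multiple of \<open>cis (- pi j / (2 N))\<close> (even \<open>j\<close>) or of that times \<open>\<i>\<close> (odd \<open>j\<close>).\<close>

lemma gauss_sum_phase:
  assumes "even N" "N > 0"
  obtains r where "r > 0" "(\<Sum>j<N. cis (pi * (real j)\<^sup>2 / real N)) = of_real r * cis (pi / 4)"
proof -
  define s where "s = - cis (- pi / real N)"
  define \<theta> where "\<theta> j = (if odd j then pi / 2 else 0) - pi * real j / (2 * real N)" for j
  have factor: "\<exists>r>0. 1 + s ^ j = of_real r * cis (\<theta> j)" if "j \<in> {1..N-1}" for j
  proof -
    define x where "x = pi * real j / (2 * real N)"
    have x: "0 < x" "x < pi / 2" using that assms by (auto simp: x_def field_simps)
    have sj: "s ^ j = (if odd j then - 1 else 1) * cis (- 2 * x)"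
    proof -
      have "real j * (- pi / real N) = - 2 * x" by (simp add: x_def)
      then have "cis (- pi / real N) ^ j = cis (- 2 * x)" by (simp only: Complex.DeMoivre)
      then show ?thesis by (simp only: s_def power_minus[of "cis _"] uminus_power_if) simp
    qed
    show ?thesis
    proof (cases "odd j")
      case True
      have "1 + s ^ j = of_real (2 * sin x) * cis (\<theta> j)"
        unfolding sj using True
        by (auto simp: complex_eq_iff \<theta>_def cos_double_sin sin_double cos_diff sin_diff power2_eq_square simp flip: x_def)
      then show ?thesis using x sin_gt_zero2[of x] by (intro exI[of _ "2 * sin x"]) auto
    next
      case False
      have "1 + s ^ j = of_real (2 * cos x) * cis (\<theta> j)"
        unfolding sj using False
        by (auto simp: complex_eq_iff \<theta>_def cos_double_cos sin_double power2_eq_square simp flip: x_def)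
      then show ?thesis using x cos_gt_zero[of x] by (intro exI[of _ "2 * cos x"]) auto
    qed
  qed
  have prod: "(\<Prod>j\<in>A. of_real (r j) * cis (\<theta> j)) = of_real (\<Prod>j\<in>A. r j) * cis (\<Sum>j\<in>A. \<theta> j)" for r and A :: "nat set"
    by (induction A rule: infinite_finite_induct) (auto simp: cis_mult algebra_simps)
  obtain r where r: "\<And>j. j \<in> {1..N-1} \<Longrightarrow> r j > 0 \<and> 1 + s ^ j = of_real (r j) * cis (\<theta> j)"
    using factor by metis
  \<comment> \<open>The \<open>N / 2\<close> odd indices contribute \<open>pi N / 4\<close>, the
    linear terms subtract \<open>pi (N - 1) / 4\<close>.\<close>
  have "(\<Sum>j=1..N-1. \<theta> j) = pi / 4"
  proof -
    obtain k where k: "N = 2 * Suc k" using assms by (metis evenE gr0_conv_Suc mult_0_right neq0_conv not0_implies_Suc)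
    have "(\<Sum>j=1..2*k+1. if odd j then pi / 2 else 0) = pi / 2 * (real k + 1)"
      by (induction k) (auto simp: algebra_simps)
    moreover have "(\<Sum>j=1..2*k+1. real j) = (2 * real k + 1) * (real k + 1)"
      by (induction k) (auto simp: algebra_simps)
    ultimately show ?thesis
      unfolding \<theta>_def sum_subtractf k
      by (simp add: field_simps flip: sum_divide_distrib sum_distrib_left)
  qed
  then have "(\<Prod>j=1..N-1. of_real (r j) * cis (\<theta> j)) = of_real (\<Prod>j=1..N-1. r j) * cis (pi / 4)"
    unfolding prod by (simp only:)
  moreover have "(\<Sum>j<N. cis (pi * (real j)\<^sup>2 / real N)) = (\<Prod>j=1..N-1. 1 + s ^ j)"
    using gauss_sum_prod[OF assms] by (simp add: s_def)
  moreover have "\<dots> = (\<Prod>j=1..N-1. of_real (r j) * cis (\<theta> j))"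
    using r by (intro prod.cong) auto
  moreover have "(\<Prod>j=1..N-1. r j) > 0" using r by (intro prod_pos) auto
  ultimately show ?thesis using that[of "\<Prod>j=1..N-1. r j"] by metis
qed

subsection \<open>Milgram's formula for positive definite even lattices\<close>

lemma cis_sum: "cis (\<Sum>i\<in>A. f i) = (\<Prod>i\<in>A. cis (f i))"
  by (induction A rule: infinite_finite_induct) (auto simp flip: cis_mult)

section \<open>Subgroups, coset representatives and characters\<close>

definition add_subgroup :: "'a::ab_group_add set \<Rightarrow> bool" where
  "add_subgroup A \<longleftrightarrow> 0 \<in> A \<and> (\<forall>x\<in>A. \<forall>y\<in>A. x - y \<in> A)"

lemma add_subgroupD:
  assumes "add_subgroup A"
  shows "0 \<in> A" "x \<in> A \<Longrightarrow> y \<in> A \<Longrightarrow> x - y \<in> A" "x \<in> A \<Longrightarrow> - x \<in> A" "x \<in> A \<Longrightarrow> y \<in> A \<Longrightarrow> x + y \<in> A"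
proof -
  show 0: "0 \<in> A" and diff: "x \<in> A \<Longrightarrow> y \<in> A \<Longrightarrow> x - y \<in> A" for x y
    using assms by (auto simp: add_subgroup_def)
  show uminus: "x \<in> A \<Longrightarrow> - x \<in> A" for x using diff[OF 0] by force
  show "x \<in> A \<Longrightarrow> y \<in> A \<Longrightarrow> x + y \<in> A" for x y using diff[OF _ uminus] by force
qed

lemma add_subgroup_of_int_scaleR:
  fixes A :: "'a::real_vector set"
  assumes "add_subgroup A" "x \<in> A"
  shows "of_int k *\<^sub>R x \<in> A"
proof -
  have nat: "of_nat n *\<^sub>R x \<in> A" for n
    using add_subgroupD[OF assms(1)] assms(2) by (induction n) (auto simp: scaleR_add_left)
  then show ?thesis
    using add_subgroupD(3)[OF assms(1) nat[of "nat (- k)"]] nat[of "nat k"] by (cases "k \<ge> 0") auto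
qed

lemma add_subgroup_sum:
  assumes "add_subgroup A" "\<And>i. i \<in> I \<Longrightarrow> f i \<in> A"
  shows "(\<Sum>i\<in>I. f i) \<in> A"
  using assms(2) by (induction I rule: infinite_finite_induct) (auto intro: add_subgroupD[OF assms(1)])

lemma add_subgroup_dual_lattice: "add_subgroup (dual_lattice L)"
  by (auto simp: add_subgroup_def dual_lattice_def inner_diff_left)

text \<open>Sums over a finite quotient are written as sums over representatives; by
  \<open>sum_transversal\<close> the choice does not matter for functions constant on
  cosets.\<close>

definition transversal :: "'a::ab_group_add set \<Rightarrow> 'a set \<Rightarrow> 'a set \<Rightarrow> bool" where
  "transversal R M G \<longleftrightarrow> finite R \<and> R \<subseteq> G \<and> (\<forall>x\<in>G. \<exists>!r. r \<in> R \<and> x - r \<in> M)"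

lemma transversalE:
  assumes "transversal R M G" "x \<in> G"
  obtains r where "r \<in> R" "x - r \<in> M"
  using assms unfolding transversal_def by metis

lemma transversal_unique:
  assumes "transversal R M G" "add_subgroup M" "r \<in> R" "r' \<in> R" "r - r' \<in> M"
  shows "r = r'"
proof -
  have "r - r \<in> M" using add_subgroupD(1)[OF assms(2)] by simp
  then show ?thesis using assms unfolding transversal_def by blast
qed

lemma transversalI:
  assumes "finite R" "R \<subseteq> G" "add_subgroup M"
    and "\<And>x. x \<in> G \<Longrightarrow> \<exists>r\<in>R. x - r \<in> M"
    and "\<And>r r'. r \<in> R \<Longrightarrow> r' \<in> R \<Longrightarrow> r - r' \<in> M \<Longrightarrow> r = r'"
  shows "transversal R M G"
  unfolding transversal_def
proof (intro conjI ballI)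
  fix x assume "x \<in> G"
  then obtain r where r: "r \<in> R" "x - r \<in> M" using assms(4) by blast
  have "r' = r" if "r' \<in> R" "x - r' \<in> M" for r'
    using add_subgroupD(2)[OF assms(3) r(2) that(2)] by (intro assms(5) that r) simp
  then show "\<exists>!r. r \<in> R \<and> x - r \<in> M" using r by blast
qed (use assms in auto)

lemma sum_transversal:
  assumes R: "transversal R M G" and R': "transversal R' M G"
    and M: "add_subgroup M"
    and f: "\<And>x y. x \<in> G \<Longrightarrow> y \<in> G \<Longrightarrow> x - y \<in> M \<Longrightarrow> f x = f y"
  shows "sum f R = sum f R'"
proof -
  have "\<exists>r'. r' \<in> R' \<and> r - r' \<in> M" if "r \<in> R" for r
    using that R transversalE[OF R'] unfolding transversal_def by (metis subsetD)
  then obtain j where j: "\<And>r. r \<in> R \<Longrightarrow> j r \<in> R'" "\<And>r. r \<in> R \<Longrightarrow> r - j r \<in> M" by metis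
  have "\<exists>r. r \<in> R \<and> r' - r \<in> M" if "r' \<in> R'" for r'
    using that R' transversalE[OF R] unfolding transversal_def by (metis subsetD)
  then obtain i where i: "\<And>r'. r' \<in> R' \<Longrightarrow> i r' \<in> R" "\<And>r'. r' \<in> R' \<Longrightarrow> r' - i r' \<in> M" by metis
  show ?thesis
  proof (rule sum.reindex_bij_witness[of R i j R' f f])
    fix r assume r: "r \<in> R"
    show "i (j r) = r"
      using add_subgroupD(4)[OF M j(2)[OF r] i(2)[OF j(1)[OF r]]] r i(1) j(1)
      by (intro transversal_unique[OF R M, symmetric]) auto
    show "f (j r) = f r" using r j R R' by (metis f subsetD transversal_def)
  next
    fix r assume r: "r \<in> R'"
    show "j (i r) = r"
      using add_subgroupD(4)[OF M i(2)[OF r] j(2)[OF i(1)[OF r]]] r i(1) j(1)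
      by (intro transversal_unique[OF R' M, symmetric]) auto
  qed (use i j in auto)
qed

lemma transversal_translate:
  assumes R: "transversal R M G" and M: "add_subgroup M" and G: "add_subgroup G" and h: "h \<in> G"
  shows "transversal ((+) h ` R) M G"
proof (rule transversalI[OF _ _ M])
  show "finite ((+) h ` R)" "(+) h ` R \<subseteq> G"
    using R h add_subgroupD(4)[OF G] by (auto simp: transversal_def)
  show "\<exists>r\<in>(+) h ` R. x - r \<in> M" if "x \<in> G" for x
    using transversalE[OF R add_subgroupD(2)[OF G that h]] by (auto simp: algebra_simps)
  show "r = r'" if "r \<in> (+) h ` R" "r' \<in> (+) h ` R" "r - r' \<in> M" for r r'
    using that transversal_unique[OF R M] by auto
qed

lemma transversal_Int:
  assumes R: "transversal R M G" and "add_subgroup M" and L: "add_subgroup L" "M \<subseteq> L" "L \<subseteq> G"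
  shows "transversal (R \<inter> L) M L"
proof (rule transversalI)
  show "\<exists>r\<in>R \<inter> L. x - r \<in> M" if x: "x \<in> L" for x
  proof -
    obtain r where r: "r \<in> R" "x - r \<in> M"
      using transversalE[OF R subsetD[OF L(3) x]] .
    have "x - (x - r) \<in> L" using x subsetD[OF L(2) r(2)] by (rule add_subgroupD(2)[OF L(1)])
    then show ?thesis using r by auto
  qed
  show "r = r'" if "r \<in> R \<inter> L" "r' \<in> R \<inter> L" "r - r' \<in> M" for r r'
    using that transversal_unique[OF R assms(2)] by auto
qed (use assms in \<open>auto simp: transversal_def\<close>)

text \<open>Modulo \<open>L\<close> the sum \<open>t + h\<close> determines \<open>t\<close>, after
  which \<open>h\<close> is determined modulo \<open>M\<close>. Injectivity is recorded so that sums
  over the image can be split into double sums.\<close>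

lemma transversal_trans:
  assumes T: "transversal T L G" and H: "transversal H M L"
    and M: "add_subgroup M" and L: "add_subgroup L" "M \<subseteq> L" and G: "add_subgroup G" "L \<subseteq> G"
  shows "transversal ((\<lambda>(t, h). t + h) ` (T \<times> H)) M G"
    and "inj_on (\<lambda>(t, h). t + h) (T \<times> H)"
proof -
  have TG: "T \<subseteq> G" and HL: "H \<subseteq> L" and fin: "finite T" "finite H"
    using T H by (auto simp: transversal_def)
  have uniq: "t = t' \<and> h = h'" if "t \<in> T" "t' \<in> T" "h \<in> H" "h' \<in> H" "(t + h) - (t' + h') \<in> M" for t t' h h'
  proof -
    have "(t + h) - (t' + h') \<in> L" "h' - h \<in> L"
      using that HL L(2) add_subgroupD(2)[OF L(1)] by blast+
    from add_subgroupD(4)[OF L(1) this] have "t - t' \<in> L" by simp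
    then have "t = t'" using that transversal_unique[OF T L(1)] by auto
    moreover from this have "h = h'" using that transversal_unique[OF H M] by auto
    ultimately show ?thesis by simp
  qed
  show "transversal ((\<lambda>(t, h). t + h) ` (T \<times> H)) M G"
  proof (rule transversalI[OF _ _ M])
    show "(\<lambda>(t, h). t + h) ` (T \<times> H) \<subseteq> G"
    proof clarify
      fix t h assume "t \<in> T" "h \<in> H"
      then have "t \<in> G" "h \<in> G" using TG HL G(2) by auto
      then show "t + h \<in> G" by (rule add_subgroupD(4)[OF G(1)])
    qed
    show "\<exists>r\<in>(\<lambda>(t, h). t + h) ` (T \<times> H). x - r \<in> M" if x: "x \<in> G" for x
    proof -
      obtain t where t: "t \<in> T" "x - t \<in> L" using transversalE[OF T x] .
      obtain h where h: "h \<in> H" "x - t - h \<in> M" using transversalE[OF H t(2)] .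
      have "x - (t + h) \<in> M" using h(2) by (simp add: diff_diff_eq)
      then show ?thesis using t h by force
    qed
    show "r = r'" if rr: "r \<in> (\<lambda>(t, h). t + h) ` (T \<times> H)" "r' \<in> (\<lambda>(t, h). t + h) ` (T \<times> H)" "r - r' \<in> M" for r r'
    proof -
      obtain t h t' h' where "t \<in> T" "h \<in> H" "r = t + h" "t' \<in> T" "h' \<in> H" "r' = t' + h'"
        using rr(1,2) by auto
      then show ?thesis using uniq[of t t' h h'] rr(3) by simp
    qed
  qed (use fin in simp)
  show "inj_on (\<lambda>(t, h). t + h) (T \<times> H)"
  proof (rule inj_onI, clarsimp)
    fix t t' h h' assume "t + h = t' + h'" "t \<in> T" "t' \<in> T" "h \<in> H" "h' \<in> H"
    then show "t = t' \<and> h = h'" using uniq[of t t' h h'] add_subgroupD(1)[OF M] by simp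
  qed
qed

lemma cis_2pi_eq_1_iff: "cis (2 * pi * t) = 1 \<longleftrightarrow> t \<in> \<int>"
proof
  assume "cis (2 * pi * t) = 1"
  then have "cos (2 * pi * t) = 1" by (simp add: complex_eq_iff)
  then obtain k :: int where "2 * pi * t = of_int k * 2 * pi" unfolding cos_one_2pi_int by blast
  then have "t = of_int k" by simp
  then show "t \<in> \<int>" by simp
qed simp

text \<open>If some \<open>g\<close> in \<open>L\<close> has \<open>x \<bullet> g\<close> not
  integral, translating the representatives by \<open>g\<close> multiplies the sum by a factor
  different from 1 without changing it.\<close>

lemma sum_character:
  assumes H: "transversal H M L" and M: "add_subgroup M" and L: "add_subgroup L" "M \<subseteq> L"
    and xM: "\<And>y. y \<in> M \<Longrightarrow> x \<bullet> y \<in> \<int>"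
  shows "(\<Sum>h\<in>H. cis (2 * pi * (x \<bullet> h))) = (if x \<in> dual_lattice L then of_nat (card H) else 0)"
proof -
  let ?\<chi> = "\<lambda>h. cis (2 * pi * (x \<bullet> h))"
  have add: "?\<chi> (g + h) = ?\<chi> g * ?\<chi> h" for g h
    by (simp add: cis_mult inner_add_right algebra_simps)
  have HL: "H \<subseteq> L" using H by (simp add: transversal_def)
  show ?thesis
  proof (cases "x \<in> dual_lattice L")
    case True
    then have "?\<chi> h = 1" if "h \<in> H" for h
      using that HL by (intro cis_multiple_2pi) (auto simp: dual_lattice_def)
    then show ?thesis using True by simp
  next
    case False
    then obtain g where g: "g \<in> L" "x \<bullet> g \<notin> \<int>" by (auto simp: dual_lattice_def)
    have "sum ?\<chi> H = sum ?\<chi> ((+) g ` H)"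
    proof (rule sum_transversal[OF H transversal_translate[OF H M L(1) g(1)] M])
      fix y z assume "y - z \<in> M"
      then have "?\<chi> (y - z) = 1" using xM by (intro cis_multiple_2pi) auto
      then show "?\<chi> y = ?\<chi> z" using add[of "y - z" z] by simp
    qed
    also have "\<dots> = ?\<chi> g * sum ?\<chi> H"
      by (subst sum.reindex) (auto simp: add sum_distrib_left)
    finally have "(?\<chi> g - 1) * sum ?\<chi> H = 0" by (simp add: algebra_simps)
    moreover have "?\<chi> g \<noteq> 1" using g by (simp add: cis_2pi_eq_1_iff)
    ultimately show ?thesis using False by simp
  qed
qed

text \<open>Gram-Schmidt inside the lattice: scaling the new vector by \<open>c\<close>, the product
  of the norms found so far, clears all denominators of the projection.\<close>

lemma orthogonal_extend:
  fixes L :: "'a::euclidean_space set"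
  assumes L: "add_subgroup L" "span L = UNIV"
    and int: "\<And>x y. x \<in> L \<Longrightarrow> y \<in> L \<Longrightarrow> x \<bullet> y \<in> \<int>"
    and "k \<le> DIM('a)"
  shows "\<exists>V\<subseteq>L. finite V \<and> pairwise orthogonal V \<and> 0 \<notin> V \<and> card V = k"
  using assms(4)
proof (induction k)
  case 0
  then show ?case by (intro exI[of _ "{}"]) auto
next
  case (Suc k)
  then obtain V where V: "V \<subseteq> L" "finite V" "pairwise orthogonal V" "0 \<notin> V" "card V = k" by auto
  have "\<not> L \<subseteq> span V"
  proof
    assume "L \<subseteq> span V"
    then have "span V = UNIV" using L(2) span_minimal subspace_span by blast
    then have "DIM('a) \<le> card V" using V(2) by (metis dim_UNIV dim_le_card' dim_span)
    then show False using Suc.prems V(5) by simp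
  qed
  then obtain w where w: "w \<in> L" "w \<notin> span V" by blast
  define c where "c = (\<Prod>v\<in>V. v \<bullet> v)"
  have vv: "v \<bullet> v \<noteq> 0" if "v \<in> V" for v using that V(4) by auto
  define u where "u = c *\<^sub>R w - (\<Sum>v\<in>V. ((w \<bullet> v) * (c / (v \<bullet> v))) *\<^sub>R v)"
  have c_int: "c \<in> \<int>" unfolding c_def using V(1) int by (intro Ints_prod) auto
  have c_div: "c / (v \<bullet> v) \<in> \<int>" if "v \<in> V" for v
  proof -
    have "c = (v \<bullet> v) * (\<Prod>v\<in>V - {v}. v \<bullet> v)"
      unfolding c_def using V(2) that by (simp add: prod.remove)
    moreover have "(\<Prod>v\<in>V - {v}. v \<bullet> v) \<in> \<int>" using V(1) int by (intro Ints_prod) auto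
    ultimately show ?thesis using vv[OF that] by simp
  qed
  have scale: "r *\<^sub>R x \<in> L" if "r \<in> \<int>" "x \<in> L" for r x
    using that add_subgroup_of_int_scaleR[OF L(1)] by (auto elim!: Ints_cases)
  have "u \<in> L"
    unfolding u_def using V(1) w int c_div c_int
    by (intro add_subgroupD(2)[OF L(1)] add_subgroup_sum[OF L(1)] scale Ints_mult) auto
  moreover have orth: "v \<bullet> u = 0" if "v \<in> V" for v
  proof -
    have "v \<bullet> (\<Sum>v'\<in>V. ((w \<bullet> v') * (c / (v' \<bullet> v'))) *\<^sub>R v') = (\<Sum>v'\<in>V. if v' = v then (w \<bullet> v) * (c / (v \<bullet> v)) * (v \<bullet> v) else 0)"
      unfolding inner_sum_right using V(3) that
      by (intro sum.cong) (auto simp: pairwise_def orthogonal_def)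
    also have "\<dots> = c * (v \<bullet> w)"
      using V(2) that vv[OF that] by (simp add: inner_commute)
    finally show ?thesis by (simp add: u_def inner_diff_right)
  qed
  moreover have "u \<noteq> 0"
  proof
    assume "u = 0"
    then have "c *\<^sub>R w = (\<Sum>v\<in>V. ((w \<bullet> v) * (c / (v \<bullet> v))) *\<^sub>R v)" by (simp add: u_def)
    also have "\<dots> \<in> span V" by (intro span_sum span_scale span_base)
    finally have "(1 / c) *\<^sub>R (c *\<^sub>R w) \<in> span V" by (rule span_scale)
    moreover have "c \<noteq> 0" unfolding c_def using V(2) vv by simp
    ultimately show False using w(2) by simp
  qed
  moreover have "u \<notin> V" using orth \<open>u \<noteq> 0\<close> by force
  moreover have "pairwise orthogonal (insert u V)"
    using V(3) orth by (intro pairwise_orthogonal_insert) (simp_all add: orthogonal_def inner_commute)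
  ultimately show ?case
    using V by (intro exI[of _ "insert u V"]) auto
qed

section \<open>Even lattices containing an orthogonal frame\<close>

lemma even_norm_inner_Ints:
  assumes L: "add_subgroup L" and even: "\<And>x. x \<in> L \<Longrightarrow> \<exists>k::int. x \<bullet> x = 2 * of_int k"
    and xy: "x \<in> L" "y \<in> L"
  shows "x \<bullet> y \<in> \<int>"
proof -
  obtain a b c :: int where "x \<bullet> x = 2 * of_int a" "y \<bullet> y = 2 * of_int b" "(x + y) \<bullet> (x + y) = 2 * of_int c"
    using even[OF xy(1)] even[OF xy(2)] even[OF add_subgroupD(4)[OF L xy]] by blast
  then have "x \<bullet> y = of_int (c - a - b)"
    by (simp add: inner_add_left inner_add_right inner_commute)
  then show ?thesis by simp
qed

text \<open>The frame \<open>V\<close> generates an orthogonal sublattice \<open>M\<close>, and the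
  chain \<open>M \<subseteq> L \<subseteq> dual_lattice L \<subseteq> M'\<close> transports
  questions about \<open>L\<close> to \<open>M\<close>, where they split into one-dimensional
  ones.\<close>

locale framed_even_lattice =
  fixes L V :: "'a::euclidean_space set"
  assumes L: "add_subgroup L"
    and even: "\<And>x. x \<in> L \<Longrightarrow> \<exists>k::int. x \<bullet> x = 2 * of_int k"
    and V: "V \<subseteq> L" "finite V" "pairwise orthogonal V" "0 \<notin> V" "card V = DIM('a)"
begin

lemma inner_int: "x \<in> L \<Longrightarrow> y \<in> L \<Longrightarrow> x \<bullet> y \<in> \<int>"
  using L even by (rule even_norm_inner_Ints)

definition N :: "'a \<Rightarrow> nat" where "N v = nat \<lfloor>v \<bullet> v\<rfloor>"

lemma inner_N:
  assumes "v \<in> V"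
  shows "v \<bullet> v = real (N v)" "Parity.even (N v)" "N v > 0"
proof -
  obtain k :: int where k: "v \<bullet> v = 2 * of_int k" using even assms V(1) by blast
  have "v \<bullet> v > 0" using assms V(4) by auto
  then have "k > 0" using k by simp
  have "v \<bullet> v = of_int (2 * k)" using k by simp
  then have N: "N v = nat (2 * k)" unfolding N_def by (simp only: floor_of_int)
  then show "v \<bullet> v = real (N v)" "N v > 0" using \<open>k > 0\<close> k by simp_all
  show "Parity.even (N v)" using N by (simp add: nat_mult_distrib)
qed

lemma frame_expansion: "x = (\<Sum>v\<in>V. ((x \<bullet> v) / N v) *\<^sub>R v)"
proof -
  define w where "w = x - (\<Sum>v\<in>V. ((x \<bullet> v) / N v) *\<^sub>R v)"
  have wv: "w \<bullet> v = 0" if v: "v \<in> V" for v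
  proof -
    have "(\<Sum>v'\<in>V. ((x \<bullet> v') / N v') *\<^sub>R v') \<bullet> v = (\<Sum>v'\<in>V. if v' = v then (x \<bullet> v) / N v * (v \<bullet> v) else 0)"
      unfolding inner_sum_left using V(3) v
      by (intro sum.cong) (auto simp: pairwise_def orthogonal_def)
    also have "\<dots> = x \<bullet> v" using V(2) v inner_N[OF v] by simp
    finally show ?thesis by (simp add: w_def inner_diff_left)
  qed
  have "orthogonal w y" if "y \<in> span V" for y
    using that by (rule orthogonal_to_span) (simp add: orthogonal_def wv)
  moreover have "span V = UNIV"
    using V by (metis dim_eq_card_independent dim_eq_full pairwise_orthogonal_independent)
  ultimately have "w \<bullet> w = 0" by (simp only: orthogonal_def UNIV_I)
  then have "w = 0" by simp
  then show ?thesis by (simp add: w_def)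
qed

lemma inner_expansion: "x \<bullet> y = (\<Sum>v\<in>V. (x \<bullet> v) * (y \<bullet> v) / N v)"
  by (subst frame_expansion[of y]) (simp add: inner_sum_right mult_ac)

lemma inner_frame:
  assumes "v \<in> V"
  shows "(\<Sum>w\<in>V. (c w / N w) *\<^sub>R w) \<bullet> v = c v"
proof -
  have "(\<Sum>w\<in>V. (c w / N w) *\<^sub>R w) \<bullet> v = (\<Sum>w\<in>V. if w = v then c v else 0)"
    unfolding inner_sum_left using V(3) assms inner_N
    by (intro sum.cong) (auto simp: pairwise_def orthogonal_def)
  then show ?thesis using V(2) assms by simp
qed

lemma frame_eqI:
  assumes "\<And>v. v \<in> V \<Longrightarrow> x \<bullet> v = y \<bullet> v"
  shows "x = y"
  using frame_expansion[of x] frame_expansion[of y] assms by simp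

text \<open>\<open>M\<close> is the integer span of the frame, \<open>M'\<close> its dual, and \<open>R\<close> the box of representatives of \<open>M'\<close>
  modulo \<open>M\<close>, all described by coordinates.\<close>

definition M :: "'a set" where "M = {x. \<forall>v\<in>V. (x \<bullet> v) / N v \<in> \<int>}"

definition M' :: "'a set" where "M' = {x. \<forall>v\<in>V. x \<bullet> v \<in> \<int>}"

definition R :: "'a set" where "R = {x. \<forall>v\<in>V. \<exists>k<N v. x \<bullet> v = real k}"

lemma add_subgroup_M: "add_subgroup M" and add_subgroup_M': "add_subgroup M'"
  by (auto simp: add_subgroup_def M_def M'_def inner_diff_left diff_divide_distrib)

lemma M_subset: "M \<subseteq> L"
proof
  fix x assume "x \<in> M"
  have "((x \<bullet> v) / N v) *\<^sub>R v \<in> L" if "v \<in> V" for v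
  proof -
    have "(x \<bullet> v) / N v \<in> \<int>" using \<open>x \<in> M\<close> that by (simp add: M_def)
    then obtain k where "(x \<bullet> v) / N v = of_int k" by (rule Ints_cases)
    then show ?thesis using that V(1) add_subgroup_of_int_scaleR[OF L, of v k] by auto
  qed
  then have "(\<Sum>v\<in>V. ((x \<bullet> v) / N v) *\<^sub>R v) \<in> L" by (rule add_subgroup_sum[OF L])
  then show "x \<in> L" using frame_expansion[of x] by simp
qed

lemma L_subset_dual: "L \<subseteq> dual_lattice L"
  using inner_int by (auto simp: dual_lattice_def)

lemma dual_subset: "dual_lattice L \<subseteq> M'"
  using V(1) by (auto simp: dual_lattice_def M'_def)

lemma inner_M_M': "x \<in> M \<Longrightarrow> y \<in> M' \<Longrightarrow> x \<bullet> y \<in> \<int>"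
proof -
  assume "x \<in> M" "y \<in> M'"
  then have "(x \<bullet> v) / N v * (y \<bullet> v) \<in> \<int>" if "v \<in> V" for v
    using that unfolding M_def M'_def by (intro Ints_mult) blast+
  then show ?thesis unfolding inner_expansion[of x y] by (intro Ints_sum) simp
qed

lemma dual_M': "dual_lattice M' = M"
proof
  show "M \<subseteq> dual_lattice M'" using inner_M_M' by (auto simp: dual_lattice_def)
  show "dual_lattice M' \<subseteq> M"
  proof
    fix x assume x: "x \<in> dual_lattice M'"
    have "(x \<bullet> v) / N v \<in> \<int>" if v: "v \<in> V" for v
    proof -
      \<comment> \<open>The vectors \<open>v / N v\<close> form the dual frame; pairing with them
        reads off the coordinates of \<open>x\<close>.\<close>
      have "(1 / N v) *\<^sub>R v \<in> M'"
        unfolding M'_def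
      proof (intro CollectI ballI)
        fix w assume "w \<in> V"
        then have "((1 / N v) *\<^sub>R v) \<bullet> w = (if w = v then 1 else 0)"
          using v V(3) inner_N[OF v] by (auto simp: pairwise_def orthogonal_def)
        then show "((1 / N v) *\<^sub>R v) \<bullet> w \<in> \<int>" by simp
      qed
      then show ?thesis using x by (force simp: dual_lattice_def)
    qed
    then show "x \<in> M" by (simp add: M_def)
  qed
qed

lemma bij_betw_R: "bij_betw (\<lambda>g. \<Sum>v\<in>V. (real (g v) / N v) *\<^sub>R v) (PiE V (\<lambda>v. {..<N v})) R"
proof -
  define \<Phi> where "\<Phi> g = (\<Sum>v\<in>V. (real (g v) / N v) *\<^sub>R v)" for g :: "'a \<Rightarrow> nat"
  define \<Psi> where "\<Psi> x = restrict (\<lambda>v. nat \<lfloor>x \<bullet> v\<rfloor>) V" for x :: 'a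
  have \<Phi>: "\<Phi> g \<bullet> v = real (g v)" if "v \<in> V" for g v
    unfolding \<Phi>_def using that by (rule inner_frame)
  have \<Psi>: "real (\<Psi> x v) = x \<bullet> v" "\<Psi> x v < N v" if xv: "x \<in> R" "v \<in> V" for x v
  proof -
    obtain k where "k < N v" "x \<bullet> v = real k" using xv unfolding R_def by blast
    then show "real (\<Psi> x v) = x \<bullet> v" "\<Psi> x v < N v" using xv(2) by (simp_all add: \<Psi>_def)
  qed
  have "bij_betw \<Phi> (PiE V (\<lambda>v. {..<N v})) R"
  proof (rule bij_betw_byWitness[where f' = \<Psi>])
    show "\<forall>g\<in>PiE V (\<lambda>v. {..<N v}). \<Psi> (\<Phi> g) = g"
    proof (intro ballI PiE_ext)
      fix g assume g: "g \<in> PiE V (\<lambda>v. {..<N v})"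
      show "\<Psi> (\<Phi> g) \<in> PiE V (\<lambda>_. UNIV)" by (simp add: \<Psi>_def)
      show "g \<in> PiE V (\<lambda>_. UNIV)" using g by (auto simp: PiE_def)
      show "\<Psi> (\<Phi> g) v = g v" if "v \<in> V" for v using that by (simp add: \<Psi>_def \<Phi>)
    qed
    show "\<forall>x\<in>R. \<Phi> (\<Psi> x) = x"
      using \<Psi>(1) by (intro ballI frame_eqI) (simp add: \<Phi>)
    show "\<Phi> ` (PiE V (\<lambda>v. {..<N v})) \<subseteq> R"
    proof (intro image_subsetI)
      fix g assume "g \<in> PiE V (\<lambda>v. {..<N v})"
      then have "g v < N v" if "v \<in> V" for v using that by (auto simp: PiE_def)
      then show "\<Phi> g \<in> R" unfolding R_def using \<Phi> by blast
    qed
    show "\<Psi> ` R \<subseteq> PiE V (\<lambda>v. {..<N v})"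
    proof (intro image_subsetI PiE_I)
      fix x v assume "x \<in> R"
      show "\<Psi> x v \<in> {..<N v}" if "v \<in> V" using \<Psi>(2) \<open>x \<in> R\<close> that by simp
      show "\<Psi> x v = undefined" if "v \<notin> V" using that by (simp add: \<Psi>_def)
    qed
  qed
  then show ?thesis unfolding \<Phi>_def .
qed

lemma transversal_R: "transversal R M M'"
proof (rule transversalI[OF _ _ add_subgroup_M])
  have "finite (PiE V (\<lambda>v. {..<N v}))" using V(2) by (intro finite_PiE) auto
  then show "finite R" using bij_betw_finite[OF bij_betw_R] by simp
  show "R \<subseteq> M'" by (auto simp: R_def M'_def)
  show "\<exists>r\<in>R. x - r \<in> M" if x: "x \<in> M'" for x
  proof
    define a where "a v = \<lfloor>x \<bullet> v\<rfloor>" for v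
    have a: "x \<bullet> v = of_int (a v)" if "v \<in> V" for v
      using x that by (auto simp: M'_def a_def)
    define r where "r = (\<Sum>v\<in>V. (of_int (a v mod int (N v)) / N v) *\<^sub>R v)"
    have r: "r \<bullet> v = of_int (a v mod int (N v))" if "v \<in> V" for v
      unfolding r_def using that by (rule inner_frame)
    show "r \<in> R"
      unfolding R_def
    proof (intro CollectI ballI)
      fix v assume v: "v \<in> V"
      have "a v mod int (N v) \<ge> 0" "a v mod int (N v) < int (N v)" using inner_N[OF v] by simp_all
      then show "\<exists>k<N v. r \<bullet> v = real k"
        unfolding r[OF v] by (intro exI[of _ "nat (a v mod int (N v))"]) auto
    qed
    show "x - r \<in> M"
      unfolding M_def
    proof (intro CollectI ballI)
      fix v assume v: "v \<in> V"
      have "(x - r) \<bullet> v = of_int (a v div int (N v) * int (N v))"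
        unfolding inner_diff_left a[OF v] r[OF v] by (simp add: minus_mod_eq_div_mult flip: of_int_diff)
      then show "(x - r) \<bullet> v / N v \<in> \<int>" using inner_N[OF v] by simp
    qed
  qed
  show "r = r'" if rr: "r \<in> R" "r' \<in> R" "r - r' \<in> M" for r r'
  proof (rule frame_eqI)
    fix v assume v: "v \<in> V"
    obtain k k' where k: "k < N v" "r \<bullet> v = real k" "k' < N v" "r' \<bullet> v = real k'"
      using rr v by (auto simp: R_def) metis
    have "(real k - real k') / N v \<in> \<int>" using rr(3) v k by (auto simp: M_def inner_diff_left)
    then obtain z :: int where "(real k - real k') / N v = of_int z" by (auto elim: Ints_cases)
    then have "real k - real k' = of_int z * real (N v)"
      using inner_N(3)[OF v] by (simp add: divide_eq_eq)
    then have "(of_int (int k - int k') :: real) = of_int (z * int (N v))" by simp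
    then have z: "int k - int k' = z * int (N v)" by (simp only: of_int_eq_iff)
    have "\<bar>int k - int k'\<bar> < int (N v)" using k by simp
    then have "\<bar>z\<bar> * int (N v) < 1 * int (N v)" unfolding z by (simp add: abs_mult)
    then have "z = 0" by (simp only: mult_less_cancel_right) auto
    then show "r \<bullet> v = r' \<bullet> v" using z k by simp
  qed
qed

text \<open>In frame coordinates the norm is a sum of terms \<open>k^2 / N v\<close>, so the sum
  factors into \<open>DIM('a)\<close> Gauss sums, each of phase \<open>pi / 4\<close>.\<close>

lemma sum_R:
  obtains \<rho> where "\<rho> > 0" "(\<Sum>x\<in>R. cis (pi * (x \<bullet> x))) = of_real \<rho> * cis (pi * real DIM('a) / 4)"
proof -
  let ?G = "\<lambda>v. \<Sum>k<N v. cis (pi * (real k)\<^sup>2 / real (N v))"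
  have "(\<Sum>x\<in>R. cis (pi * (x \<bullet> x))) = (\<Sum>g\<in>PiE V (\<lambda>v. {..<N v}). \<Prod>v\<in>V. cis (pi * (real (g v))\<^sup>2 / N v))"
  proof (subst sum.reindex_bij_betw[OF bij_betw_R, symmetric], intro sum.cong refl)
    fix g
    let ?x = "\<Sum>v\<in>V. (real (g v) / N v) *\<^sub>R v"
    have "?x \<bullet> ?x = (\<Sum>v\<in>V. (real (g v))\<^sup>2 / N v)"
      by (subst inner_expansion) (simp add: inner_frame[of _ "\<lambda>v. real (g v)"] power2_eq_square)
    then show "cis (pi * (?x \<bullet> ?x)) = (\<Prod>v\<in>V. cis (pi * (real (g v))\<^sup>2 / N v))"
      by (simp add: sum_distrib_left flip: cis_sum)
  qed
  also have "\<dots> = (\<Prod>v\<in>V. ?G v)"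
    using V(2) by (simp add: prod_sum_PiE)
  finally have eq: "(\<Sum>x\<in>R. cis (pi * (x \<bullet> x))) = (\<Prod>v\<in>V. ?G v)" .
  have "\<exists>r>0. ?G v = of_real r * cis (pi / 4)" if "v \<in> V" for v
    using gauss_sum_phase[of "N v"] inner_N[OF that] by metis
  then obtain r where r: "\<And>v. v \<in> V \<Longrightarrow> r v > 0 \<and> ?G v = of_real (r v) * cis (pi / 4)" by metis
  have "(\<Prod>v\<in>V. ?G v) = (\<Prod>v\<in>V. of_real (r v) * cis (pi / 4))" using r by (intro prod.cong) auto
  also have "\<dots> = of_real (\<Prod>v\<in>V. r v) * cis (pi / 4) ^ DIM('a)"
    by (simp add: prod.distrib V(5))
  also have "cis (pi / 4) ^ DIM('a) = cis (pi * real DIM('a) / 4)"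
    unfolding Complex.DeMoivre by (simp add: mult_ac)
  finally have "(\<Prod>v\<in>V. ?G v) = of_real (\<Prod>v\<in>V. r v) * cis (pi * real DIM('a) / 4)" .
  moreover have "(\<Prod>v\<in>V. r v) > 0" using r by (intro prod_pos) auto
  ultimately show ?thesis using that eq by metis
qed

text \<open>The term \<open>h \<bullet> h\<close> is even and contributes a full period, so a shift
  by \<open>h\<close> only introduces a character.\<close>

lemma cis_norm_add:
  assumes "h \<in> L"
  shows "cis (pi * ((x + h) \<bullet> (x + h))) = cis (pi * (x \<bullet> x)) * cis (2 * pi * (x \<bullet> h))"
proof -
  obtain k :: int where k: "h \<bullet> h = 2 * of_int k" using even assms by blast
  have "cis (pi * ((x + h) \<bullet> (x + h))) = cis (pi * (x \<bullet> x)) * cis (2 * pi * (x \<bullet> h)) * cis (2 * pi * of_int k)"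
    unfolding cis_mult by (rule arg_cong[of _ _ cis]) (simp add: inner_add_left inner_add_right inner_commute k algebra_simps)
  then show ?thesis by simp
qed

text \<open>Double counting of the character sum over pairs \<open>(x, h)\<close>: summing over
  \<open>h\<close> first keeps only the \<open>x\<close> dual to \<open>K\<close>, summing over
  \<open>x\<close> first keeps only \<open>h = 0\<close>.\<close>

lemma card_Int_dual:
  assumes K: "add_subgroup K" "M \<subseteq> K" "K \<subseteq> M'"
  shows "card (R \<inter> K) * card (R \<inter> dual_lattice K) = card R"
proof -
  let ?\<chi> = "\<lambda>x h. cis (2 * pi * (x \<bullet> h))"
  have fin: "finite R" using transversal_R by (simp add: transversal_def)
  have "(\<Sum>x\<in>R. \<Sum>h\<in>R \<inter> K. ?\<chi> x h) = (\<Sum>x\<in>R. if x \<in> dual_lattice K then of_nat (card (R \<inter> K)) else 0)"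
  proof (intro sum.cong refl sum_character)
    show "transversal (R \<inter> K) M K" by (rule transversal_Int[OF transversal_R add_subgroup_M K])
    show "x \<bullet> y \<in> \<int>" if "x \<in> R" "y \<in> M" for x y
      using inner_M_M'[of y x] that transversal_R by (auto simp: transversal_def inner_commute)
  qed (use K add_subgroup_M in auto)
  also have "\<dots> = of_nat (card (R \<inter> K) * card (R \<inter> dual_lattice K))"
    using fin by (simp add: sum.If_cases Int_def mult.commute)
  finally have 1: "(\<Sum>x\<in>R. \<Sum>h\<in>R \<inter> K. ?\<chi> x h) = of_nat (card (R \<inter> K) * card (R \<inter> dual_lattice K))" .
  have "(\<Sum>x\<in>R. \<Sum>h\<in>R \<inter> K. ?\<chi> x h) = (\<Sum>h\<in>R \<inter> K. \<Sum>x\<in>R. ?\<chi> h x)"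
    by (subst sum.swap) (simp add: inner_commute)
  also have "\<dots> = (\<Sum>h\<in>R \<inter> K. if h \<in> M then of_nat (card R) else 0)"
  proof (intro sum.cong refl)
    fix h assume "h \<in> R \<inter> K"
    then show "(\<Sum>x\<in>R. ?\<chi> h x) = (if h \<in> M then of_nat (card R) else 0)"
      unfolding dual_M'[symmetric]
      using K(3) M_subset L_subset_dual dual_subset inner_M_M' dual_M'
      by (intro sum_character[OF transversal_R add_subgroup_M add_subgroup_M']) (auto simp: inner_commute)
  qed
  also have "\<dots> = of_nat (card (R \<inter> K \<inter> M) * card R)"
    using fin by (simp add: sum.If_cases Int_def)
  also have "R \<inter> K \<inter> M = {0}"
  proof -
    have "0 \<in> R" using inner_N by (auto simp: R_def intro!: exI[of _ 0])
    moreover have "0 \<in> M" "0 \<in> K" using add_subgroup_M K add_subgroupD(1) by blast+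
    moreover have "x = 0" if "x \<in> R" "x \<in> M" for x
      using transversal_unique[OF transversal_R add_subgroup_M that(1) \<open>0 \<in> R\<close>] that by simp
    ultimately show ?thesis by auto
  qed
  finally have "of_nat (card (R \<inter> K) * card (R \<inter> dual_lattice K)) = (of_nat (card R) :: complex)"
    using 1 by simp
  then show ?thesis by (simp only: of_nat_eq_iff)
qed

text \<open>The index formula for \<open>L\<close> and for its dual shows that \<open>L\<close> and
  its double dual have equally many representatives in \<open>R\<close>; one contains the other, so
  they coincide.\<close>

lemma dual_dual: "dual_lattice (dual_lattice L) = L"
proof
  show "L \<subseteq> dual_lattice (dual_lattice L)"
    by (auto simp: dual_lattice_def inner_commute)
  show "dual_lattice (dual_lattice L) \<subseteq> L"
  proof
    fix x assume x: "x \<in> dual_lattice (dual_lattice L)"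
    have LM: "M \<subseteq> dual_lattice L" "L \<subseteq> M'"
      using M_subset L_subset_dual dual_subset by auto
    have fin: "finite R" using transversal_R by (simp add: transversal_def)
    have pos: "card (R \<inter> dual_lattice L) > 0"
    proof -
      obtain r where "r \<in> R" "0 - r \<in> M"
        using transversalE[OF transversal_R add_subgroupD(1)[OF add_subgroup_M']] .
      then have "r \<in> R \<inter> dual_lattice L"
        using LM(1) add_subgroupD(3)[OF add_subgroup_dual_lattice, of "- r" L] by auto
      then show ?thesis using fin by (auto simp: card_gt_0_iff)
    qed
    have "card (R \<inter> L) * card (R \<inter> dual_lattice L) = card (R \<inter> dual_lattice (dual_lattice L)) * card (R \<inter> dual_lattice L)"
      using card_Int_dual[OF L M_subset LM(2)] card_Int_dual[OF add_subgroup_dual_lattice LM(1) dual_subset]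
      by (simp add: mult.commute)
    then have card: "card (R \<inter> L) = card (R \<inter> dual_lattice (dual_lattice L))" using pos by simp
    have sub: "L \<subseteq> dual_lattice (dual_lattice L)"
      by (auto simp: dual_lattice_def inner_commute)
    have "R \<inter> L = R \<inter> dual_lattice (dual_lattice L)"
      using fin sub card by (intro card_subset_eq) auto
    moreover have "x \<in> M'"
      using x subsetD[OF L_subset_dual] subsetD[OF V(1)] unfolding M'_def dual_lattice_def[of "dual_lattice L"] by blast
    then obtain r where r: "r \<in> R" "x - r \<in> M" using transversalE[OF transversal_R] by blast
    moreover have "r \<in> dual_lattice (dual_lattice L)"
      using add_subgroupD(2)[OF add_subgroup_dual_lattice x, of "x - r"] r M_subset sub by auto
    ultimately have "r \<in> L" by auto
    then show "x \<in> L"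
      using add_subgroupD(4)[OF L, of "x - r" r] r M_subset by auto
  qed
qed

text \<open>The Gauss sum over \<open>R\<close> is \<open>card H\<close> times the one over
  \<open>T\<close>, a positive factor, so both have the same phase.\<close>

lemma sum_discriminant:
  assumes T: "transversal T L (dual_lattice L)"
  obtains \<rho> where "\<rho> > 0" "(\<Sum>t\<in>T. cis (pi * (t \<bullet> t))) = of_real \<rho> * cis (pi * real DIM('a) / 4)"
proof -
  let ?e = "\<lambda>x. cis (pi * (x \<bullet> x))"
  let ?D = "dual_lattice L"
  define H where "H = R \<inter> L"
  have incl: "M \<subseteq> ?D" "L \<subseteq> M'" using M_subset L_subset_dual dual_subset by auto
  have H: "transversal H M L"
    unfolding H_def by (rule transversal_Int[OF transversal_R add_subgroup_M L M_subset incl(2)])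
  have D: "transversal (R \<inter> ?D) M ?D"
    by (rule transversal_Int[OF transversal_R add_subgroup_M add_subgroup_dual_lattice incl(1) dual_subset])
  have fin: "finite R" using transversal_R by (simp add: transversal_def)
  have HL: "H \<subseteq> L" by (simp add: H_def)
  have inv: "?e x = ?e y" if "x \<in> M'" "y \<in> M'" "x - y \<in> M" for x y
  proof -
    have "?e (y + (x - y)) = ?e y * cis (2 * pi * (y \<bullet> (x - y)))"
      using that M_subset by (intro cis_norm_add) auto
    moreover have "y \<bullet> (x - y) \<in> \<int>" using inner_M_M'[OF that(3,2)] by (simp add: inner_commute)
    ultimately show ?thesis by simp
  qed
  have H0: "card H > 0"
  proof -
    obtain r where "r \<in> H" using transversalE[OF H add_subgroupD(1)[OF L]] by blast
    then show ?thesis using fin by (auto simp: card_gt_0_iff H_def)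
  qed
  text \<open>Averaging over \<open>H\<close> kills the terms outside the dual of \<open>L\<close>.\<close>
  have "of_nat (card H) * sum ?e R = (\<Sum>h\<in>H. \<Sum>x\<in>R. ?e (h + x))"
  proof -
    have translate: "(\<Sum>x\<in>R. ?e (h + x)) = sum ?e R" if "h \<in> H" for h
    proof -
      have "h \<in> M'" using that HL incl by auto
      then have "sum ?e R = sum ?e ((+) h ` R)"
        by (intro sum_transversal[OF transversal_R transversal_translate[OF transversal_R add_subgroup_M add_subgroup_M'] add_subgroup_M] inv)
      then show ?thesis by (simp add: sum.reindex)
    qed
    have "(\<Sum>h\<in>H. \<Sum>x\<in>R. ?e (h + x)) = (\<Sum>h\<in>H. sum ?e R)"
      by (rule sum.cong) (simp_all add: translate)
    then show ?thesis by simp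
  qed
  also have "\<dots> = (\<Sum>h\<in>H. \<Sum>x\<in>R. ?e x * cis (2 * pi * (x \<bullet> h)))"
    using HL by (intro sum.cong refl) (simp add: cis_norm_add[of _ _, symmetric] subset_iff add.commute)
  also have "\<dots> = (\<Sum>x\<in>R. ?e x * (\<Sum>h\<in>H. cis (2 * pi * (x \<bullet> h))))"
    by (subst sum.swap) (simp add: sum_distrib_left)
  also have "\<dots> = (\<Sum>x\<in>R. if x \<in> ?D then of_nat (card H) * ?e x else 0)"
  proof (intro sum.cong refl)
    fix x assume "x \<in> R"
    then have "x \<bullet> y \<in> \<int>" if "y \<in> M" for y
      using inner_M_M'[of y x] that transversal_R by (auto simp: transversal_def inner_commute)
    then show "?e x * (\<Sum>h\<in>H. cis (2 * pi * (x \<bullet> h))) = (if x \<in> ?D then of_nat (card H) * ?e x else 0)"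
      using sum_character[OF H add_subgroup_M L M_subset, of x] by simp
  qed
  also have "\<dots> = of_nat (card H) * sum ?e (R \<inter> ?D)"
    using fin by (simp add: sum.If_cases Int_def sum_distrib_left)
  finally have 1: "sum ?e R = sum ?e (R \<inter> ?D)" using H0 by simp
  have "sum ?e (R \<inter> ?D) = sum ?e ((\<lambda>(t, h). t + h) ` (T \<times> H))"
    using dual_subset
    by (intro sum_transversal[OF D transversal_trans(1)[OF T H add_subgroup_M L M_subset add_subgroup_dual_lattice L_subset_dual] add_subgroup_M] inv) auto
  also have "\<dots> = (\<Sum>(t, h)\<in>T \<times> H. ?e (t + h))"
    by (subst sum.reindex[OF transversal_trans(2)[OF T H add_subgroup_M L M_subset add_subgroup_dual_lattice L_subset_dual]])
      (simp add: case_prod_unfold)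
  also have "\<dots> = (\<Sum>(t, h)\<in>T \<times> H. ?e t)"
  proof (intro sum.cong refl, clarsimp)
    fix t h assume "t \<in> T" "h \<in> H"
    then have "t \<bullet> h \<in> \<int>" using T HL by (auto simp: transversal_def dual_lattice_def)
    then show "?e (t + h) = ?e t" using \<open>h \<in> H\<close> HL by (subst cis_norm_add) auto
  qed
  also have "\<dots> = of_nat (card H) * sum ?e T"
    by (simp add: sum.cartesian_product[symmetric] sum_distrib_left)
  finally have 2: "sum ?e (R \<inter> ?D) = of_nat (card H) * sum ?e T" .
  obtain \<rho> where \<rho>: "\<rho> > 0" "sum ?e R = of_real \<rho> * cis (pi * real DIM('a) / 4)"
    using sum_R by metis
  have "sum ?e T = sum ?e R / of_nat (card H)" using 1 2 H0 by simp
  also have "\<dots> = of_real (\<rho> / card H) * cis (pi * real DIM('a) / 4)" by (simp add: \<rho>)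
  finally show ?thesis using that \<rho>(1) H0 by (metis divide_pos_pos of_nat_0_less_iff)
qed

end

lemma even_lattice_dual:
  fixes L :: "'a::euclidean_space set"
  assumes "add_subgroup L" "span L = UNIV"
    and even: "\<And>x. x \<in> L \<Longrightarrow> \<exists>k::int. x \<bullet> x = 2 * of_int k"
  shows even_lattice_double_dual: "dual_lattice (dual_lattice L) = L"
    and milgram: "transversal T L (dual_lattice L) \<Longrightarrow>
      \<exists>\<rho>>0. (\<Sum>t\<in>T. cis (pi * (t \<bullet> t))) = of_real \<rho> * cis (pi * real DIM('a) / 4)"
proof -
  have int: "x \<bullet> y \<in> \<int>" if "x \<in> L" "y \<in> L" for x y
    using assms(1) even that by (rule even_norm_inner_Ints)
  obtain V where "V \<subseteq> L" "finite V" "pairwise orthogonal V" "0 \<notin> V" "card V = DIM('a)"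
    using orthogonal_extend[OF assms(1,2) int order_refl] by blast
  then interpret framed_even_lattice L V
    by unfold_locales (use assms in auto)
  show "dual_lattice (dual_lattice L) = L" by (rule dual_dual)
  show "transversal T L (dual_lattice L) \<Longrightarrow>
      \<exists>\<rho>>0. (\<Sum>t\<in>T. cis (pi * (t \<bullet> t))) = of_real \<rho> * cis (pi * real DIM('a) / 4)"
    using sum_discriminant by metis
qed

subsection \<open>Cyclic quotients\<close>

context
  fixes G L :: "'a::real_vector set" and g :: 'a and n :: nat
  assumes G: "add_subgroup G" and L: "add_subgroup L" and "L \<subseteq> G" and g: "g \<in> G" and n: "n > 0"
    and ex: "\<And>y. y \<in> G \<Longrightarrow> \<exists>k::int. y - of_int k *\<^sub>R g \<in> L"
    and iff: "\<And>k::int. of_int k *\<^sub>R g \<in> L \<longleftrightarrow> int n dvd k"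
begin

lemma cyclic_quotient_remainder:
  assumes "y \<in> G"
  shows "\<exists>!k::int. k \<in> {0..<int n} \<and> y - of_int k *\<^sub>R g \<in> L"
proof -
  obtain k :: int where k: "y - of_int k *\<^sub>R g \<in> L" using ex[OF assms] by blast
  have "of_int (k - k mod int n) *\<^sub>R g \<in> L" unfolding iff by (simp add: minus_mod_eq_div_mult)
  from add_subgroupD(4)[OF L k this] have k': "y - of_int (k mod int n) *\<^sub>R g \<in> L"
    by (simp add: scaleR_diff_left)
  show ?thesis
  proof (intro ex1I[of _ "k mod int n"] conjI k')
    show "k mod int n \<in> {0..<int n}" using n by simp
    fix j assume j: "j \<in> {0..<int n} \<and> y - of_int j *\<^sub>R g \<in> L"
    then have "of_int (j - k mod int n) *\<^sub>R g \<in> L"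
      using add_subgroupD(2)[OF L k', of "y - of_int j *\<^sub>R g"] by (simp add: scaleR_diff_left)
    then have "j mod int n = (k mod int n) mod int n" unfolding iff mod_eq_dvd_iff .
    then show "j = k mod int n" using j by simp
  qed
qed

lemma cyclic_quotient_transversal: "transversal ((\<lambda>k. of_nat k *\<^sub>R g) ` {..<n}) L G"
proof (rule transversalI[OF _ _ L])
  show "(\<lambda>k. of_nat k *\<^sub>R g) ` {..<n} \<subseteq> G"
    using add_subgroup_of_int_scaleR[OF G g, of "int _"] by auto
  show "\<exists>r\<in>(\<lambda>k. of_nat k *\<^sub>R g) ` {..<n}. y - r \<in> L" if y: "y \<in> G" for y
  proof -
    obtain k :: int where "k \<in> {0..<int n}" "y - of_int k *\<^sub>R g \<in> L"
      using cyclic_quotient_remainder[OF y] by blast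
    then show ?thesis by (intro bexI[of _ "of_nat (nat k) *\<^sub>R g"] image_eqI[of _ _ "nat k"]) auto
  qed
  show "r = r'" if rr: "r \<in> (\<lambda>k. of_nat k *\<^sub>R g) ` {..<n}" "r' \<in> (\<lambda>k. of_nat k *\<^sub>R g) ` {..<n}" "r - r' \<in> L" for r r'
  proof -
    obtain k k' where k: "k < n" "r = of_nat k *\<^sub>R g" "k' < n" "r' = of_nat k' *\<^sub>R g" using rr by auto
    then have "of_int (int k - int k') *\<^sub>R g \<in> L" using rr(3) by (simp add: scaleR_diff_left)
    then have "int k mod int n = int k' mod int n" unfolding iff by (simp add: mod_eq_dvd_iff)
    then show ?thesis using k by simp
  qed
qed simp

lemma inj_on_cyclic_multiples: "inj_on (\<lambda>k. of_nat k *\<^sub>R g) {..<n}"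
proof (rule inj_onI)
  fix k k' assume k: "k \<in> {..<n}" "k' \<in> {..<n}" "of_nat k *\<^sub>R g = of_nat k' *\<^sub>R g"
  then have "of_int (int k - int k') *\<^sub>R g = 0" by (simp only: of_int_diff scaleR_diff_left of_int_of_nat_eq diff_self)
  then have "of_int (int k - int k') *\<^sub>R g \<in> L" using add_subgroupD(1)[OF L] by (simp only:)
  then have "int k mod int n = int k' mod int n" unfolding iff by (simp add: mod_eq_dvd_iff)
  then show "k = k'" using k by simp
qed

text \<open>The first isomorphism theorem for the map \<open>f\<close> taking \<open>y\<close> to
  its remainder, that is the multiple of \<open>g\<close> congruent to it modulo
  \<open>L\<close>.\<close>

lemma cyclic_quotient_iso: "additive_group G Mod L \<cong> integer_mod_group n"
proof -
  define f where "f y = (THE k::int. k \<in> {0..<int n} \<and> y - of_int k *\<^sub>R g \<in> L)" for y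
  have f: "f y \<in> {0..<int n}" "y - of_int (f y) *\<^sub>R g \<in> L" if "y \<in> G" for y
    using theI'[OF cyclic_quotient_remainder[OF that]] unfolding f_def by auto
  have f_eqI: "f y = k mod int n" if "y \<in> G" "y - of_int k *\<^sub>R g \<in> L" for y k
  proof -
    have "of_int (k - f y) *\<^sub>R g \<in> L"
      using add_subgroupD(2)[OF L f(2)[OF that(1)] that(2)] by (simp add: scaleR_diff_left)
    then have "k mod int n = f y mod int n" unfolding iff by (simp add: mod_eq_dvd_iff)
    then show ?thesis using f(1)[OF that(1)] by simp
  qed
  have grp: "group (additive_group G)"
  proof (rule groupI)
    show "\<exists>y\<in>carrier (additive_group G). y \<otimes>\<^bsub>additive_group G\<^esub> x = \<one>\<^bsub>additive_group G\<^esub>"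
      if "x \<in> carrier (additive_group G)" for x
      using that add_subgroupD(3)[OF G, of x] by (intro bexI[of _ "- x"]) (auto simp: additive_group_def)
  qed (use add_subgroupD[OF G] in \<open>auto simp: additive_group_def add.assoc\<close>)
  have hom: "f \<in> hom (additive_group G) (integer_mod_group n)"
  proof (rule homI)
    show "f x \<in> carrier (integer_mod_group n)" if "x \<in> carrier (additive_group G)" for x
      using f(1)[of x] that n by (simp add: additive_group_def carrier_integer_mod_group)
    fix x y assume "x \<in> carrier (additive_group G)" "y \<in> carrier (additive_group G)"
    then have xy: "x \<in> G" "y \<in> G" by (simp_all add: additive_group_def)
    have "x + y - of_int (f x + f y) *\<^sub>R g \<in> L"
      using add_subgroupD(4)[OF L f(2)[OF xy(1)] f(2)[OF xy(2)]] by (simp add: scaleR_add_left algebra_simps)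
    then show "f (x \<otimes>\<^bsub>additive_group G\<^esub> y) = f x \<otimes>\<^bsub>integer_mod_group n\<^esub> f y"
      using f_eqI[OF add_subgroupD(4)[OF G xy]] by (simp add: additive_group_def)
  qed
  interpret group_hom "additive_group G" "integer_mod_group n" f
    by (intro group_hom.intro group_hom_axioms.intro grp hom) simp
  have "f ` carrier (additive_group G) = carrier (integer_mod_group n)"
  proof
    show "carrier (integer_mod_group n) \<subseteq> f ` carrier (additive_group G)"
    proof
      fix k assume "k \<in> carrier (integer_mod_group n)"
      then have k: "k \<in> {0..<int n}" using n by (simp add: carrier_integer_mod_group)
      have kG: "of_int k *\<^sub>R g \<in> G" using add_subgroup_of_int_scaleR[OF G g] .
      have "f (of_int k *\<^sub>R g) = k" using f_eqI[OF kG, of k] k add_subgroupD(1)[OF L] by simp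
      then show "k \<in> f ` carrier (additive_group G)" using kG by (force simp: additive_group_def)
    qed
  qed auto
  moreover have "kernel (additive_group G) (integer_mod_group n) f = L"
  proof -
    have "f y = 0 \<longleftrightarrow> y \<in> L" if "y \<in> G" for y
      using f_eqI[OF that, of 0] f(2)[OF that] by auto
    then show ?thesis using \<open>L \<subseteq> G\<close> by (auto simp: kernel_def additive_group_def)
  qed
  ultimately show ?thesis using FactGroup_iso by simp
qed

end

subsection \<open>The lattice of a tight 5-design\<close>

text \<open>Off-diagonal terms occur in equal pairs. Applied to Gram forms, it reduces evenness of a
  lattice to the diagonal entries.\<close>

lemma even_symmetric_sum:
  fixes f :: "'a \<Rightarrow> 'a \<Rightarrow> int"
  assumes "finite A" "\<And>u v. u \<in> A \<Longrightarrow> v \<in> A \<Longrightarrow> f u v = f v u" "\<And>u. u \<in> A \<Longrightarrow> even (f u u)"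
  shows "even (\<Sum>u\<in>A. \<Sum>v\<in>A. f u v)"
  using assms
proof (induction A rule: finite_induct)
  case (insert w A)
  have "(\<Sum>u\<in>insert w A. \<Sum>v\<in>insert w A. f u v)
      = f w w + (\<Sum>v\<in>A. f w v) + ((\<Sum>u\<in>A. f u w) + (\<Sum>u\<in>A. \<Sum>v\<in>A. f u v))"
    using insert.hyps by (simp add: sum.distrib)
  moreover have "(\<Sum>u\<in>A. f u w) = (\<Sum>v\<in>A. f w v)"
    using insert.prems by (intro sum.cong) auto
  moreover have "even (\<Sum>u\<in>A. \<Sum>v\<in>A. f u v)" using insert by simp
  ultimately show ?case using insert.prems(2)[of w] by simp
qed simp

lemma int_power4_minus_power2_dvd: "(12::int) dvd k ^ 4 - k\<^sup>2"
proof -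
  have "(12::int) dvd r ^ 4 - r\<^sup>2" if "r \<in> {0..<12}" for r
  proof -
    have "r \<in> {0, 1, 2, 3, 4, 5, 6, 7, 8, 9, 10, 11}" using that unfolding atLeastLessThan_iff insert_iff empty_iff by presburger
    then show ?thesis by auto
  qed
  then have "(12::int) dvd (k mod 12) ^ 4 - (k mod 12)\<^sup>2" by simp
  moreover have "[(k mod 12) ^ 4 - (k mod 12)\<^sup>2 = k ^ 4 - k\<^sup>2] (mod 12)"
    by (intro cong_diff cong_pow) (simp_all add: cong_def)
  ultimately show ?thesis by (simp only: cong_dvd_iff)
qed

text \<open>The design rescaled by \<open>1 / sqrt 2\<close>, so that \<Gamma> is
  \<open>even_int_span U\<close> with no scalar in front. Inner products within \<open>U\<close> are
  half those within \<open>X\<close>; the second and fourth moments are divided by 2 and 4.\<close>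

locale scaled_design =
  fixes m :: nat and U :: "'a::euclidean_space set"
  assumes m: "m \<ge> 1" "even m" "\<not> 8 dvd m"
    and squarefree: "\<And>p. prime p \<Longrightarrow> odd p \<Longrightarrow> \<not> p\<^sup>2 dvd m * (m + 1)"
    and finite_U: "finite U"
    and norm_U: "\<And>u. u \<in> U \<Longrightarrow> u \<bullet> u = real (2 * m + 1) / 2"
    and inner_U: "\<And>u v. u \<in> U \<Longrightarrow> v \<in> U \<Longrightarrow> u \<noteq> v \<Longrightarrow> u \<bullet> v = 1 / 2 \<or> u \<bullet> v = - 1 / 2"
    and moment2: "\<And>y. (\<Sum>u\<in>U. (u \<bullet> y)\<^sup>2) = real m * (real m + 1) * real (2 * m + 1) * (y \<bullet> y)"
    and moment4: "\<And>y. (\<Sum>u\<in>U. (u \<bullet> y) ^ 4) = 3 / 2 * (real m * (real m + 1)) * (y \<bullet> y)\<^sup>2"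
    and dim: "DIM('a) + 1 = 4 * (m * (m + 1))"
begin

abbreviation L :: "'a set" where "L \<equiv> even_int_span U"

definition K :: "'a set" where "K = {y. \<forall>u\<in>U. y \<bullet> u \<in> \<int>}"

definition excess :: "'a \<Rightarrow> 'a \<Rightarrow> int" where "excess u v = \<lfloor>u \<bullet> v - 1 / 2\<rfloor>"

lemma inner_excess:
  assumes "u \<in> U" "v \<in> U"
  shows "u \<bullet> v = 1 / 2 + of_int (excess u v)"
proof -
  have "u \<bullet> v - 1 / 2 = of_int (int m) \<or> u \<bullet> v - 1 / 2 = of_int 0 \<or> u \<bullet> v - 1 / 2 = of_int (- 1)"
    using norm_U[OF assms(1)] inner_U[OF assms] by (cases "u = v") (auto simp: field_simps)
  then have "of_int (excess u v) = u \<bullet> v - 1 / 2"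
    unfolding excess_def by (metis floor_of_int)
  then show ?thesis by simp
qed

lemma excess_self:
  assumes "u \<in> U"
  shows "excess u u = int m"
proof -
  have "of_int (excess u u) = (of_int (int m) :: real)"
    using inner_excess[OF assms assms] norm_U[OF assms] by (simp add: field_simps)
  then show ?thesis by (simp only: of_int_eq_iff)
qed

lemma even_combinationI:
  assumes "even (\<Sum>u\<in>U. c u)" "x = (\<Sum>u\<in>U. of_int (c u) *\<^sub>R u)"
  shows "x \<in> L"
  using assms unfolding even_int_span_def by blast

lemma even_combinationE:
  assumes "x \<in> L"
  obtains c k where "(\<Sum>u\<in>U. c u) = 2 * k" "x = (\<Sum>u\<in>U. of_int (c u) *\<^sub>R u)"
  using assms unfolding even_int_span_def by (auto elim: evenE)

lemma add_subgroup_L: "add_subgroup L"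
  unfolding add_subgroup_def
proof (intro conjI ballI)
  show "0 \<in> L" by (rule even_combinationI[of "\<lambda>_. 0"]) auto
  fix x y assume "x \<in> L" "y \<in> L"
  then obtain c k c' k' where c: "(\<Sum>u\<in>U. c u) = 2 * k" "x = (\<Sum>u\<in>U. of_int (c u) *\<^sub>R u)"
    "(\<Sum>u\<in>U. c' u) = 2 * k'" "y = (\<Sum>u\<in>U. of_int (c' u) *\<^sub>R u)"
    by (auto elim!: even_combinationE)
  show "x - y \<in> L"
    by (rule even_combinationI[of "\<lambda>u. c u - c' u"]) (simp_all add: c sum_subtractf scaleR_diff_left)
qed

lemma combination_in_L:
  assumes "u \<in> U" "v \<in> U" "even (a + b)"
  shows "of_int a *\<^sub>R u + of_int b *\<^sub>R v \<in> L"
\<comment> \<open>Adding two indicator coefficients also covers \<open>u = v\<close>, the case that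
  yields \<open>2 u\<close>.\<close>
proof (rule even_combinationI[of "\<lambda>w. (if w = u then a else 0) + (if w = v then b else 0)"])
  have "(\<Sum>w\<in>U. of_int ((if w = u then a else 0) + (if w = v then b else 0)) *\<^sub>R w)
     = (\<Sum>w\<in>U. if w = u then of_int a *\<^sub>R w else 0) + (\<Sum>w\<in>U. if w = v then of_int b *\<^sub>R w else 0)"
    unfolding sum.distrib[symmetric] by (intro sum.cong) (auto simp: scaleR_add_left)
  then show "of_int a *\<^sub>R u + of_int b *\<^sub>R v = (\<Sum>w\<in>U. of_int ((if w = u then a else 0) + (if w = v then b else 0)) *\<^sub>R w)"
    using assms finite_U by simp
qed (use assms finite_U in \<open>simp add: sum.distrib\<close>)

text \<open>All inner products in \<open>U\<close> are \<open>1 / 2\<close> plus an integer. The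
  halves contribute \<open>(2 k)^2 / 2 = 2 k^2\<close>; the integers \<open>excess u v\<close> form
  a symmetric matrix whose diagonal entry \<open>m\<close> is even.\<close>

lemma L_even:
  assumes "x \<in> L"
  shows "\<exists>k::int. x \<bullet> x = 2 * of_int k"
proof -
  obtain c k where c: "(\<Sum>u\<in>U. c u) = 2 * k" "x = (\<Sum>u\<in>U. of_int (c u) *\<^sub>R u)" using assms by (rule even_combinationE)
  have "even (\<Sum>u\<in>U. \<Sum>v\<in>U. c u * c v * excess u v)"
  proof (rule even_symmetric_sum[OF finite_U])
    show "c u * c v * excess u v = c v * c u * excess v u" for u v
      by (simp add: excess_def inner_commute mult_ac)
    show "even (c u * c u * excess u u)" if "u \<in> U" for u
      using m(2) excess_self[OF that] by simp
  qed
  then obtain j where j: "(\<Sum>u\<in>U. \<Sum>v\<in>U. c u * c v * excess u v) = 2 * j" by (rule evenE)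
  have "x \<bullet> x = (\<Sum>u\<in>U. \<Sum>v\<in>U. of_int (c u) * of_int (c v) * (u \<bullet> v))"
    unfolding c(2) inner_sum_left inner_sum_right by (simp add: inner_commute mult_ac)
  also have "\<dots> = (\<Sum>u\<in>U. \<Sum>v\<in>U. of_int (c u) * of_int (c v) / 2 + of_int (c u * c v * excess u v))"
    by (intro sum.cong refl) (simp add: inner_excess algebra_simps)
  also have "\<dots> = (\<Sum>u\<in>U. of_int (c u)) * (\<Sum>v\<in>U. of_int (c v)) / 2 + of_int (\<Sum>u\<in>U. \<Sum>v\<in>U. c u * c v * excess u v)"
    by (simp add: sum.distrib sum_product sum_divide_distrib)
  also have "(\<Sum>u\<in>U. of_int (c u)) = (2 * of_int k :: real)"
    using arg_cong[OF c(1), of "of_int :: int \<Rightarrow> real"] by simp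
  finally have "x \<bullet> x = 2 * of_int (k\<^sup>2 + j)" unfolding j by (simp add: power2_eq_square)
  then show ?thesis by blast
qed

lemma U_nonempty: "U \<noteq> {}"
proof
  assume "U = {}"
  obtain b :: 'a where "b \<in> Basis" using nonempty_Basis by blast
  then have "b \<bullet> b = 1" by simp
  then show False using moment2[of b] \<open>U = {}\<close> m(1) by simp
qed

text \<open>A vector orthogonal to \<open>L\<close> is orthogonal to every \<open>2 u\<close>, hence
  to \<open>U\<close>, and then the second moment identity forces it to be 0.\<close>

lemma span_L: "span L = UNIV"
proof (rule ccontr)
  assume "span L \<noteq> UNIV"
  then obtain a where a: "a \<noteq> 0" "\<And>x. x \<in> span L \<Longrightarrow> a \<bullet> x = 0"
    using span_not_UNIV_orthogonal[of L] by blast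
  have "u \<bullet> a = 0" if "u \<in> U" for u
  proof -
    have "of_int 2 *\<^sub>R u + of_int 0 *\<^sub>R u \<in> L" using that by (intro combination_in_L) auto
    then have "a \<bullet> (of_int 2 *\<^sub>R u + of_int 0 *\<^sub>R u) = 0" by (intro a(2) span_base)
    then show ?thesis by (simp add: inner_commute)
  qed
  then have "real m * (real m + 1) * real (2 * m + 1) * (a \<bullet> a) = 0"
    unfolding moment2[symmetric] by simp
  then show False using a(1) m(1) by simp
qed

lemma dual_dual_L: "dual_lattice (dual_lattice L) = L"
  using add_subgroup_L span_L L_even by (rule even_lattice_double_dual)

lemma L_subset_K: "L \<subseteq> K"
proof
  fix x assume "x \<in> L"
  then obtain c k where c: "(\<Sum>u\<in>U. c u) = 2 * k" "x = (\<Sum>u\<in>U. of_int (c u) *\<^sub>R u)" by (rule even_combinationE)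
  have "x \<bullet> v \<in> \<int>" if v: "v \<in> U" for v
  proof -
    have "x \<bullet> v = (\<Sum>u\<in>U. of_int (c u) / 2 + of_int (c u * excess u v))"
      unfolding c(2) inner_sum_left using v by (intro sum.cong refl) (simp add: inner_excess algebra_simps)
    also have "\<dots> = of_int (\<Sum>u\<in>U. c u) / 2 + of_int (\<Sum>u\<in>U. c u * excess u v)"
      by (simp add: sum.distrib sum_divide_distrib)
    also have "\<dots> = of_int (k + (\<Sum>u\<in>U. c u * excess u v))" unfolding c(1) by simp
    finally show ?thesis by (simp only: Ints_of_int)
  qed
  then show "x \<in> K" by (simp add: K_def)
qed

lemma K_subset_dual: "K \<subseteq> dual_lattice L"
proof
  fix y assume y: "y \<in> K"
  have "y \<bullet> x \<in> \<int>" if x: "x \<in> L" for x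
  proof -
    obtain c k where "(\<Sum>u\<in>U. c u) = 2 * k" "x = (\<Sum>u\<in>U. of_int (c u) *\<^sub>R u)" using x by (rule even_combinationE)
    then show ?thesis using y by (auto simp: inner_sum_right K_def intro!: Ints_sum Ints_mult)
  qed
  then show "y \<in> dual_lattice L" by (simp add: dual_lattice_def)
qed

lemma U_subset_dual: "U \<subseteq> dual_lattice L"
proof
  fix u assume "u \<in> U"
  then have "x \<bullet> u \<in> \<int>" if "x \<in> L" for x using that L_subset_K by (auto simp: K_def)
  then show "u \<in> dual_lattice L" by (simp add: dual_lattice_def inner_commute)
qed

lemma add_subgroup_K: "add_subgroup K"
  by (auto simp: add_subgroup_def K_def inner_diff_left)

lemma U_not_K:
  assumes "u \<in> U"
  shows "of_int k *\<^sub>R u \<in> K \<longleftrightarrow> even k"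
proof
  assume "of_int k *\<^sub>R u \<in> K"
  then have "of_int k * (u \<bullet> u) \<in> \<int>" using assms by (auto simp: K_def)
  then obtain j where "of_int k * (u \<bullet> u) = of_int j" by (rule Ints_cases)
  then have "of_int (k * (2 * int m + 1)) = (of_int (2 * j) :: real)"
    unfolding norm_U[OF assms] by (simp add: field_simps)
  then have "k * (2 * int m + 1) = 2 * j" by (simp only: of_int_eq_iff)
  then have "even (k * (2 * int m + 1))" by simp
  then show "even k" by simp
next
  assume "even k"
  then have "of_int k *\<^sub>R u + of_int 0 *\<^sub>R u \<in> L" using assms by (intro combination_in_L) auto
  then show "of_int k *\<^sub>R u \<in> K" using L_subset_K by auto
qed

text \<open>Pairing \<open>y\<close> with \<open>v - w\<close> and \<open>2 v\<close> shows that the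
  numbers \<open>y \<bullet> v\<close> are all integers or all half of odd integers. Every inner
  product of \<open>u\<close> with \<open>U\<close> is half of an odd integer, so subtracting
  \<open>u\<close> repairs the second case.\<close>

lemma dual_cases:
  assumes "y \<in> dual_lattice L" "u \<in> U"
  obtains "y \<in> K" | "y - u \<in> K"
proof (cases "y \<in> K")
  case False
  have diff: "y \<bullet> v - y \<bullet> w \<in> \<int>" if "v \<in> U" "w \<in> U" for v w
  proof -
    have "of_int 1 *\<^sub>R v + of_int (- 1) *\<^sub>R w \<in> L" using that by (intro combination_in_L) auto
    then have "y \<bullet> (of_int 1 *\<^sub>R v + of_int (- 1) *\<^sub>R w) \<in> \<int>"
      using assms(1) unfolding dual_lattice_def by blast
    then show ?thesis by (simp add: inner_diff_right)
  qed
  have double: "2 * (y \<bullet> v) \<in> \<int>" if "v \<in> U" for v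
  proof -
    have "of_int 2 *\<^sub>R v + of_int 0 *\<^sub>R v \<in> L" using that by (intro combination_in_L) auto
    then have "y \<bullet> (of_int 2 *\<^sub>R v + of_int 0 *\<^sub>R v) \<in> \<int>"
      using assms(1) unfolding dual_lattice_def by blast
    then show ?thesis by simp
  qed
  obtain w where w: "w \<in> U" "y \<bullet> w \<notin> \<int>" using False by (auto simp: K_def)
  have "(y - u) \<bullet> v \<in> \<int>" if v: "v \<in> U" for v
  proof -
    have "y \<bullet> v \<notin> \<int>"
      using Ints_add[OF _ diff[OF w(1) v]] w(2) by auto
    obtain j where j: "2 * (y \<bullet> v) = of_int j" using double[OF v] by (rule Ints_cases)
    have "odd j"
    proof
      assume "even j"
      then obtain i where "j = 2 * i" by (rule evenE)
      then have "y \<bullet> v = of_int i" using j by simp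
      then show False using \<open>y \<bullet> v \<notin> \<int>\<close> by simp
    qed
    then obtain i where "j = 2 * i + 1" by (rule oddE)
    then have "(y - u) \<bullet> v = of_int (i - excess u v)"
      using j inner_excess[OF assms(2) v] by (simp add: inner_diff_left)
    then show ?thesis by (simp only: Ints_of_int)
  qed
  then show ?thesis using that(2) by (simp add: K_def)
qed

lemma K_norm_rat:
  assumes "y \<in> K"
  shows "3 * (y \<bullet> y) / 2 \<in> \<rat>"
proof -
  have "(\<Sum>u\<in>U. (u \<bullet> y)\<^sup>2) \<in> \<int>"
    using assms by (intro Ints_sum Ints_power) (auto simp: K_def inner_commute)
  then have "(\<Sum>u\<in>U. (u \<bullet> y)\<^sup>2) \<in> \<rat>" using Ints_subset_Rats by blast
  moreover have "y \<bullet> y = (\<Sum>u\<in>U. (u \<bullet> y)\<^sup>2) / (real m * (real m + 1) * real (2 * m + 1))"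
    unfolding moment2 using m(1) by simp
  ultimately have "y \<bullet> y \<in> \<rat>" by (metis Rats_add Rats_divide Rats_mult Rats_of_nat Rats_1)
  then show ?thesis by simp
qed

text \<open>Substituting \<open>y \<bullet> y = 2 b / 3\<close> makes the fourth moment minus the
  second \<open>2/3\<close> of \<open>m (m + 1) b (b - d)\<close>, where \<open>d = 2 m + 1\<close>.
  This explains the scaling of \<open>b\<close> and the constant
  \<open>18 = 12 * 3 / 2\<close>.\<close>

lemma K_moment_dvd:
  assumes "y \<in> K" "b = 3 * (y \<bullet> y) / 2"
  obtains z :: int where "real m * (real m + 1) * (b * (b - real (2 * m + 1))) = 18 * of_int z"
proof -
  define k where "k u = \<lfloor>u \<bullet> y\<rfloor>" for u
  have k: "u \<bullet> y = of_int (k u)" if "u \<in> U" for u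
    using assms(1) that by (auto simp: K_def k_def inner_commute)
  have "12 dvd (\<Sum>u\<in>U. k u ^ 4 - (k u)\<^sup>2)"
    by (intro dvd_sum int_power4_minus_power2_dvd)
  then obtain z where z: "(\<Sum>u\<in>U. k u ^ 4 - (k u)\<^sup>2) = 12 * z" by (rule dvdE)
  have "(\<Sum>u\<in>U. (u \<bullet> y) ^ 4) - (\<Sum>u\<in>U. (u \<bullet> y)\<^sup>2) = of_int (\<Sum>u\<in>U. k u ^ 4 - (k u)\<^sup>2)"
    by (simp add: k sum_subtractf)
  then have "3 / 2 * (real m * (real m + 1)) * (y \<bullet> y)\<^sup>2 - real m * (real m + 1) * real (2 * m + 1) * (y \<bullet> y) = 12 * of_int z"
    unfolding moment2 moment4 z by simp
  moreover have "y \<bullet> y = 2 * b / 3" using assms(2) by simp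
  moreover have "A * (b * (b - d)) = 3 / 2 * (3 / 2 * A * (2 * b / 3)\<^sup>2 - A * d * (2 * b / 3))" for A d
    by (simp add: power2_eq_square algebra_simps)
  ultimately have "real m * (real m + 1) * (b * (b - real (2 * m + 1))) = 3 / 2 * (12 * of_int z)"
    by metis
  then show ?thesis using that[of z] by (simp add: algebra_simps)
qed

text \<open>The second and fourth moments of an integral vector differ by a multiple of 12. In lowest terms
  this forces \<open>b = 3 (y, y) / 2\<close> to be an integer, and then \<open>3\<close> to divide \<open>b (b - d)\<close>, where \<open>d = 2 m + 1\<close>.\<close>

lemma K_norm:
  assumes "y \<in> K"
  obtains b :: int where "3 * (y \<bullet> y) = 2 * of_int b" "3 dvd b \<or> 3 dvd b - (2 * int m + 1)"
proof -
  define Q where "Q = int (m * (m + 1))"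
  define b where "b = 3 * (y \<bullet> y) / 2"
  define d where "d = 2 * int m + 1"
  obtain s t :: int where st: "t > 0" "coprime s t" "b = of_int s / of_int t"
    using K_norm_rat[OF assms] unfolding b_def by (rule Rats_cases')
  obtain z where "real m * (real m + 1) * (b * (b - real (2 * m + 1))) = 18 * of_int z"
    using K_moment_dvd[OF assms b_def] .
  moreover have "real m * (real m + 1) = of_int Q" "real (2 * m + 1) = of_int d"
    by (simp_all add: Q_def d_def algebra_simps)
  ultimately have "of_int Q * (b * (b - of_int d)) = 18 * (of_int z :: real)"
    by (simp only:)
  then have "of_int Q * (of_int s * (of_int s - of_int d * of_int t)) = (18 * of_int z * of_int t * of_int t :: real)"
    unfolding st(3) using st(1) by (simp add: field_simps)
  then have "(of_int (Q * (s * (s - d * t))) :: real) = of_int (18 * z * (t * t))"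
    by simp
  then have eq: "Q * (s * (s - d * t)) = 18 * z * (t * t)" by (simp only: of_int_eq_iff)
  have sq: "\<not> (int p)\<^sup>2 dvd Q" if "prime p" "odd p" for p
  proof
    assume "(int p)\<^sup>2 dvd Q"
    then have "int (p\<^sup>2) dvd int (m * (m + 1))" by (simp add: Q_def)
    then show False using squarefree[OF that] unfolding int_dvd_int_iff by blast
  qed
  \<comment> \<open>With this, prime powers dividing the right side of \<open>eq\<close> through
    \<open>t * t\<close> must already divide \<open>Q\<close>.\<close>
  have coprime_st: "coprime t (s * (s - d * t))"
  proof -
    have "coprime t s" using st(2) by (simp add: coprime_commute)
    moreover have "coprime t (s - d * t)"
    proof (rule coprimeI)
      fix c assume c: "c dvd t" "c dvd s - d * t"
      then have "c dvd (s - d * t) + d * t" by (intro dvd_add dvd_mult)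
      then have "c dvd s" by simp
      then show "is_unit c" using \<open>coprime t s\<close> c(1) by (metis coprime_common_divisor)
    qed
    ultimately show ?thesis by simp
  qed
  have "t = 1"
  proof (rule ccontr)
    assume "t \<noteq> 1"
    then have "nat t \<noteq> 1" using st(1) by linarith
    then obtain p where p: "prime p" "p dvd nat t" using prime_factor_nat by blast
    then have "int p dvd int (nat t)" by (simp only: int_dvd_int_iff)
    then have pt: "int p dvd t" using st(1) by simp
    have cop: "coprime (int p) (s * (s - d * t))"
      using coprime_st pt by (metis coprime_divisors dvd_refl)
    have pp: "(int p)\<^sup>2 dvd t * t" using pt by (simp add: power2_eq_square mult_dvd_mono)
    show False
    proof (cases "odd p")
      case True
      have "(int p)\<^sup>2 dvd Q * (s * (s - d * t))" unfolding eq using pp by simp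
      then have "(int p)\<^sup>2 dvd Q" using cop by (simp add: coprime_dvd_mult_left_iff)
      then show False using sq p True by blast
    next
      case False
      then have "p = 2" using primes_dvd_imp_eq[OF two_is_prime_nat p(1)] by simp
      \<comment> \<open>One factor 2 comes from 18 and two from \<open>t * t\<close>, giving the 8
        that contradicts the hypothesis on \<open>m\<close>.\<close>
      have "(2 * 2\<^sup>2 :: int) dvd 18 * z * (t * t)"
        using pp \<open>p = 2\<close> by (intro mult_dvd_mono) auto
      then have "2 ^ 3 dvd Q * (s * (s - d * t))" unfolding eq by simp
      moreover have "coprime (2::int) (s * (s - d * t))"
        using cop \<open>p = 2\<close> by (simp only: of_nat_numeral)
      then have "coprime ((2::int) ^ 3) (s * (s - d * t))"
        unfolding coprime_power_left_iff ..
      ultimately have "2 ^ 3 dvd Q" by (simp only: coprime_dvd_mult_left_iff)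
      then have "int (2 ^ 3) dvd int (m * (m + 1))" by (simp add: Q_def)
      then have "2 ^ 3 dvd m * (m + 1)" by (simp only: int_dvd_int_iff)
      moreover have "coprime (2 ^ 3) (m + 1)"
        unfolding coprime_power_left_iff using m(2) by simp
      ultimately have "2 ^ 3 dvd m" by (simp only: coprime_dvd_mult_left_iff)
      then show False using m(3) by simp
    qed
  qed
  \<comment> \<open>The factor 9 of 18 cannot be carried by \<open>Q\<close> alone.\<close>
  have "3 dvd s * (s - d)"
  proof (rule ccontr)
    assume "\<not> 3 dvd s * (s - d)"
    then have "coprime (3::int) (s * (s - d))" by (intro prime_imp_coprime) auto
    then have "coprime ((3::int)\<^sup>2) (s * (s - d))" unfolding coprime_power_left_iff ..
    moreover have "(3::int)\<^sup>2 dvd Q * (s * (s - d))" using eq \<open>t = 1\<close> by simp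
    ultimately have "(3::int)\<^sup>2 dvd Q" by (simp only: coprime_dvd_mult_left_iff)
    then show False using sq[of 3] by simp
  qed
  then have "3 dvd s \<or> 3 dvd s - d" by (subst (asm) prime_dvd_mult_iff) auto
  moreover have "3 * (y \<bullet> y) = 2 * of_int s" using st(3) \<open>t = 1\<close> by (simp add: b_def)
  ultimately show ?thesis using that[of s] by (simp add: d_def)
qed

section \<open>The quadratic form modulo 3 and the discriminant group\<close>

definition nrm :: "'a \<Rightarrow> int" where "nrm y = \<lfloor>3 * (y \<bullet> y) / 2\<rfloor>"

text \<open>The polar form of \<open>nrm\<close>. On \<open>K\<close> the floor in
  \<open>nrm\<close> is exact, and \<open>B x y\<close> equals
  \<open>3 (x \<bullet> y)\<close>.\<close>

definition B :: "'a \<Rightarrow> 'a \<Rightarrow> int" where "B x y = nrm (x + y) - nrm x - nrm y"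

lemma nrm_K:
  assumes "y \<in> K"
  shows "3 * (y \<bullet> y) = 2 * of_int (nrm y)" "3 dvd nrm y \<or> 3 dvd nrm y - (2 * int m + 1)"
proof -
  obtain b :: int where b: "3 * (y \<bullet> y) = 2 * of_int b" "3 dvd b \<or> 3 dvd b - (2 * int m + 1)"
    using K_norm[OF assms] .
  moreover have "nrm y = b" unfolding nrm_def b by simp
  ultimately show "3 * (y \<bullet> y) = 2 * of_int (nrm y)" "3 dvd nrm y \<or> 3 dvd nrm y - (2 * int m + 1)" by simp_all
qed

lemma inner_B:
  assumes "x \<in> K" "y \<in> K"
  shows "3 * (x \<bullet> y) = of_int (B x y)"
  using nrm_K(1)[OF assms(1)] nrm_K(1)[OF assms(2)] nrm_K(1)[OF add_subgroupD(4)[OF add_subgroup_K assms]]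
  by (simp add: B_def inner_add_left inner_add_right inner_commute algebra_simps)

text \<open>Nondegeneracy of the form on \<open>K / L\<close>: such an \<open>x\<close> is integral
  on \<open>K\<close> and, lying in \<open>K\<close>, also on \<open>u\<close>, hence on the whole
  dual by \<open>dual_cases\<close>; the double dual is \<open>L\<close>.\<close>

lemma mem_L:
  assumes x: "x \<in> K" and B3: "\<And>y. y \<in> K \<Longrightarrow> 3 dvd B x y"
  shows "x \<in> L"
proof -
  obtain u where u: "u \<in> U" using U_nonempty by blast
  have int: "x \<bullet> y \<in> \<int>" if y: "y \<in> K" for y
  proof -
    obtain j where "B x y = 3 * j" using B3[OF y] by (rule dvdE)
    then have "x \<bullet> y = of_int j" using inner_B[OF x y] by simp
    then show ?thesis by simp
  qed
  have "x \<bullet> y \<in> \<int>" if "y \<in> dual_lattice L" for y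
    using that u
  proof (cases rule: dual_cases)
    case 2
    have "x \<bullet> u \<in> \<int>" using x u by (simp add: K_def)
    then have "x \<bullet> (y - u) + x \<bullet> u \<in> \<int>" using int[OF 2] by (rule Ints_add[rotated])
    then show ?thesis by (simp add: inner_diff_right)
  qed (rule int)
  then have "x \<in> dual_lattice (dual_lattice L)" by (simp add: dual_lattice_def)
  then show ?thesis using dual_dual_L by simp
qed

lemma nrm_L:
  assumes "x \<in> L"
  shows "3 dvd nrm x"
proof -
  obtain k :: int where "x \<bullet> x = 2 * of_int k" using L_even[OF assms] by blast
  then have "of_int (nrm x) = (of_int (3 * k) :: real)"
    using nrm_K(1)[of x] assms L_subset_K by auto
  then show ?thesis by (simp only: of_int_eq_iff) simp
qed

lemma DIM_mod_8: "\<exists>j. pi * real DIM('a) / 4 = 2 * pi * of_int j - pi / 4"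
proof -
  obtain k where k: "m * (m + 1) = 2 * k" using m(2) by (metis dvd_mult2 evenE)
  then have "real (DIM('a) + 1) = real (8 * k)" using dim by (simp only:)
  then have n: "real DIM('a) = 8 * real k - 1" by simp
  have "pi * real DIM('a) / 4 = 2 * pi * of_int (int k) - pi / 4" unfolding n by (simp add: field_simps)
  then show ?thesis by blast
qed

text \<open>As \<open>n = -1\<close> modulo 8, the Gauss sum lies on the open ray of angle
  \<open>- pi / 4\<close>. The imaginary part excludes \<open>K = L\<close>, the real part later
  decides the residue of \<open>nrm g\<close>.\<close>

lemma milgram_sign:
  assumes "transversal T L (dual_lattice L)"
  shows "Re (\<Sum>t\<in>T. cis (pi * (t \<bullet> t))) > 0" "Im (\<Sum>t\<in>T. cis (pi * (t \<bullet> t))) < 0"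
proof -
  obtain \<rho> where \<rho>: "\<rho> > 0" "(\<Sum>t\<in>T. cis (pi * (t \<bullet> t))) = of_real \<rho> * cis (pi * real DIM('a) / 4)"
    using milgram[OF add_subgroup_L span_L L_even assms] by blast
  obtain j where j: "pi * real DIM('a) / 4 = 2 * pi * of_int j - pi / 4" using DIM_mod_8 by blast
  have "cis (pi * real DIM('a) / 4) = cis (2 * pi * of_int j) * cis (- (pi / 4))"
    unfolding cis_mult j by simp
  then have "cis (pi * real DIM('a) / 4) = cis (- (pi / 4))" by simp
  then show "Re (\<Sum>t\<in>T. cis (pi * (t \<bullet> t))) > 0" "Im (\<Sum>t\<in>T. cis (pi * (t \<bullet> t))) < 0"
    unfolding \<rho>(2) using \<rho>(1) by (simp_all add: cos_45 sin_45)
qed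

text \<open>Otherwise the discriminant group would have order 2, with Gauss sum \<open>1 + \<i>\<close>.\<close>

lemma ex_nrm_not_dvd: "\<exists>g\<in>K. \<not> 3 dvd nrm g"
proof (rule ccontr)
  assume "\<not> ?thesis"
  then have "3 dvd B x y" if "x \<in> K" "y \<in> K" for x y
    using that add_subgroupD(4)[OF add_subgroup_K that] unfolding B_def by (intro dvd_diff) auto
  then have KL: "K = L" using mem_L L_subset_K by blast
  obtain u where u: "u \<in> U" using U_nonempty by blast
  have u1: "u \<notin> L" using U_not_K[OF u, of 1] KL by simp
  have "transversal {0, u} L (dual_lattice L)"
  proof (rule transversalI)
    show "{0, u} \<subseteq> dual_lattice L"
      using U_subset_dual u add_subgroupD(1)[OF add_subgroup_dual_lattice] by auto
    show "\<exists>r\<in>{0, u}. x - r \<in> L" if "x \<in> dual_lattice L" for x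
      using that u by (cases rule: dual_cases) (auto simp: KL)
    show "r = r'" if "r \<in> {0, u}" "r' \<in> {0, u}" "r - r' \<in> L" for r r'
      using that u1 add_subgroupD(3)[OF add_subgroup_L, of "- u"] by auto
  qed (simp_all add: add_subgroup_L)
  from milgram_sign(2)[OF this] have "Im (cis (pi * (u \<bullet> u))) < 0"
    using u1 add_subgroupD(1)[OF add_subgroup_L] by (subst (asm) sum.insert) auto
  moreover obtain k where "m = 2 * k" using m(2) by (rule evenE)
  then have "pi * (u \<bullet> u) = 2 * pi * of_int (int k) + pi / 2"
    unfolding norm_U[OF u] by (simp add: field_simps)
  then have "cis (pi * (u \<bullet> u)) = cis (2 * pi * of_int (int k)) * cis (pi / 2)"
    by (simp only: cis_mult)
  then have "cis (pi * (u \<bullet> u)) = \<i>" by simp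
  ultimately show False by simp
qed

text \<open>Modulo 3 the quadratic form \<open>nrm\<close> on \<open>K\<close> takes no values besides \<open>0\<close> and \<open>d\<close>, so it vanishes on the
  orthogonal complement of \<open>g\<close>.\<close>

lemma K_decompose:
  assumes g: "g \<in> K" "\<not> 3 dvd nrm g" and x: "x \<in> K"
  obtains j :: int where "x - of_int j *\<^sub>R g \<in> L"
proof -
  define d where "d = 2 * int m + 1"
  have gd: "3 dvd nrm g - d" using nrm_K(2)[OF g(1)] g(2) by (auto simp: d_def)
  then have d3: "\<not> 3 dvd d" using g(2) by (metis dvd_diffD1 zdvd_zdiffD)
  have nrm_orth: "3 dvd nrm x" if "x \<in> K" "3 dvd B x g" for x
  proof (rule ccontr)
    assume "\<not> 3 dvd nrm x"
    then have "3 dvd nrm x - d" using nrm_K(2)[OF that(1)] by (auto simp: d_def)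
    \<comment> \<open>Modulo 3 this would be \<open>2 d\<close>, which is neither \<open>0\<close>
      nor \<open>d\<close>.\<close>
    moreover have "nrm (x + g) = nrm x + nrm g + B x g" by (simp add: B_def)
    moreover have "3 dvd nrm (x + g) \<or> 3 dvd nrm (x + g) - d"
      using nrm_K(2)[OF add_subgroupD(4)[OF add_subgroup_K that(1) g(1)]] by (simp add: d_def)
    ultimately show False using gd that(2) d3 by presburger
  qed
  have B_shift: "B (x - of_int j *\<^sub>R g) y = B x y - j * B g y" if "x \<in> K" "y \<in> K" for x y j
  proof -
    have "of_int j *\<^sub>R g \<in> K" using add_subgroup_of_int_scaleR[OF add_subgroup_K g(1)] .
    then have "x - of_int j *\<^sub>R g \<in> K" using add_subgroupD(2)[OF add_subgroup_K] that by blast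
    then have "of_int (B (x - of_int j *\<^sub>R g) y) = (of_int (B x y - j * B g y) :: real)"
      using that g(1) by (simp add: inner_diff_left flip: inner_B)
    then show ?thesis by (simp only: of_int_eq_iff)
  qed
  have Bgg: "B g g = 2 * nrm g"
  proof -
    have "of_int (B g g) = (of_int (2 * nrm g) :: real)" using inner_B[OF g(1) g(1)] nrm_K(1)[OF g(1)] by simp
    then show ?thesis by (simp only: of_int_eq_iff)
  qed
  have B_sym: "B x y = B y x" for x y by (simp add: B_def add.commute)
  have orth: "\<exists>j. 3 dvd B (x - of_int j *\<^sub>R g) g \<and> x - of_int j *\<^sub>R g \<in> K" if "x \<in> K" for x
  proof -
    \<comment> \<open>Because \<open>2 * nrm g\<close> is invertible modulo 3, one of the three
      residues serves as projection coefficient.\<close>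
    have "3 dvd B x g - 0 * (2 * nrm g) \<or> 3 dvd B x g - 1 * (2 * nrm g) \<or> 3 dvd B x g - 2 * (2 * nrm g)"
      using g(2) by presburger
    then obtain j where "3 dvd B x g - j * (2 * nrm g)" by blast
    then have "3 dvd B (x - of_int j *\<^sub>R g) g" using B_shift[OF that g(1)] Bgg by simp
    moreover have "x - of_int j *\<^sub>R g \<in> K"
      using add_subgroupD(2)[OF add_subgroup_K that add_subgroup_of_int_scaleR[OF add_subgroup_K g(1)]] .
    ultimately show ?thesis by blast
  qed
  obtain j where j: "3 dvd B (x - of_int j *\<^sub>R g) g" "x - of_int j *\<^sub>R g \<in> K" using orth[OF x] by blast
  define x' where "x' = x - of_int j *\<^sub>R g"
  have x': "x' \<in> K" "3 dvd B x' g" using j by (simp_all add: x'_def)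
  have "x' \<in> L"
  proof (rule mem_L[OF x'(1)])
    fix y assume y: "y \<in> K"
    obtain i where i: "3 dvd B (y - of_int i *\<^sub>R g) g" "y - of_int i *\<^sub>R g \<in> K" using orth[OF y] by blast
    define y' where "y' = y - of_int i *\<^sub>R g"
    have y': "y' \<in> K" "3 dvd B y' g" using i by (simp_all add: y'_def)
    have "B (x' + y') g = B x' g + B y' g"
    proof -
      have "of_int (B (x' + y') g) = (of_int (B x' g + B y' g) :: real)"
        using x'(1) y'(1) g(1) add_subgroupD(4)[OF add_subgroup_K x'(1) y'(1)]
        by (simp add: inner_add_left flip: inner_B)
      then show ?thesis by (simp only: of_int_eq_iff)
    qed
    \<comment> \<open>The vectors \<open>x'\<close>, \<open>y'\<close> and their sum are all
      orthogonal to \<open>g\<close> modulo 3, so polarization kills \<open>B x' y'\<close>; the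
      multiple of \<open>g\<close> removed from \<open>y\<close> pairs trivially with
      \<open>x'\<close>.\<close>
    then have "3 dvd nrm (x' + y')"
      using x' y' by (intro nrm_orth add_subgroupD(4)[OF add_subgroup_K]) auto
    then have "3 dvd B x' y'"
      unfolding B_def using nrm_orth[OF x'] nrm_orth[OF y'] by (intro dvd_diff)
    moreover have "B x' y' = B x' y - i * B g x'"
      using B_shift[OF y x'(1), of i] by (simp add: y'_def B_sym)
    ultimately show "3 dvd B x' y"
      using x'(2) by (metis B_sym diff_add_cancel dvd_add dvd_mult)
  qed
  then show ?thesis using that by (simp add: x'_def)
qed

lemma discriminant:
  shows "additive_group (dual_lattice L) Mod L \<cong> integer_mod_group 6" "[int m = - 1] (mod 3)"
proof -
  let ?D = "dual_lattice L"
  note D = add_subgroup_dual_lattice[of L]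
  obtain g where g: "g \<in> K" "\<not> 3 dvd nrm g" using ex_nrm_not_dvd by blast
  obtain u where u: "u \<in> U" using U_nonempty by blast
  \<comment> \<open>Modulo \<open>L\<close> the vector \<open>u\<close> has order 2 and
    \<open>g\<close> has order 3, so their sum should generate the discriminant group.\<close>
  define h where "h = u + g"
  have mult_u: "of_int k *\<^sub>R u \<in> L" if "even k" for k
    using combination_in_L[OF u u, of k 0] that by simp
  have nrm_mult: "nrm (of_int k *\<^sub>R g) = k\<^sup>2 * nrm g" for k
  proof -
    have "of_int (nrm (of_int k *\<^sub>R g)) = (of_int (k\<^sup>2 * nrm g) :: real)"
      using nrm_K(1)[OF g(1)] nrm_K(1)[OF add_subgroup_of_int_scaleR[OF add_subgroup_K g(1)], of k]
      by (simp add: power2_eq_square algebra_simps)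
    then show ?thesis by (simp only: of_int_eq_iff)
  qed
  have mult_g: "of_int k *\<^sub>R g \<in> L \<longleftrightarrow> 3 dvd k" for k
  proof
    assume "of_int k *\<^sub>R g \<in> L"
    then have "3 dvd k\<^sup>2 * nrm g" using nrm_L nrm_mult by metis
    then have "3 dvd k\<^sup>2" using g(2) by (subst (asm) prime_dvd_mult_iff) auto
    then show "3 dvd k" by (rule prime_dvd_power[rotated]) simp
  next
    assume "3 dvd k"
    then obtain i where i: "k = 3 * i" by (rule dvdE)
    show "of_int k *\<^sub>R g \<in> L"
    proof (rule mem_L)
      show kK: "of_int k *\<^sub>R g \<in> K" by (rule add_subgroup_of_int_scaleR[OF add_subgroup_K g(1)])
      fix y assume y: "y \<in> K"
      have "of_int (B (of_int k *\<^sub>R g) y) = of_int k * (3 * (g \<bullet> y))"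
        unfolding inner_B[OF kK y, symmetric] by simp
      also have "\<dots> = of_int (3 * (i * B g y))"
        unfolding inner_B[OF g(1) y] i by simp
      finally have "of_int (B (of_int k *\<^sub>R g) y) = (of_int (3 * (i * B g y)) :: real)" .
      then have "B (of_int k *\<^sub>R g) y = 3 * (i * B g y)" by (simp only: of_int_eq_iff)
      then show "3 dvd B (of_int k *\<^sub>R g) y" by simp
    qed
  qed
  have hD: "h \<in> ?D"
    unfolding h_def using u g U_subset_dual K_subset_dual by (intro add_subgroupD(4)[OF D]) auto
  have iff: "of_int k *\<^sub>R h \<in> L \<longleftrightarrow> int 6 dvd k" for k
  proof
    assume hL: "of_int k *\<^sub>R h \<in> L"
    have "of_int k *\<^sub>R h - of_int k *\<^sub>R g \<in> K"
      using hL L_subset_K add_subgroup_of_int_scaleR[OF add_subgroup_K g(1), of k]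
      by (intro add_subgroupD(2)[OF add_subgroup_K]) auto
    then have k2: "even k" using U_not_K[OF u, of k] by (simp add: h_def scaleR_add_right)
    have "of_int k *\<^sub>R h - of_int k *\<^sub>R u \<in> L"
      by (intro add_subgroupD(2)[OF add_subgroup_L] hL mult_u k2)
    then have "3 dvd k" using mult_g[of k] by (simp add: h_def scaleR_add_right)
    then show "int 6 dvd k" using k2 by presburger
  next
    assume "int 6 dvd k"
    then have "even k" "3 dvd k" by presburger+
    then show "of_int k *\<^sub>R h \<in> L"
      unfolding h_def scaleR_add_right by (intro add_subgroupD(4)[OF add_subgroup_L] mult_u) (simp_all add: mult_g)
  qed
  have ex: "\<exists>k::int. y - of_int k *\<^sub>R h \<in> L" if y: "y \<in> ?D" for y
  proof -
    have "\<exists>i j. y - of_int i *\<^sub>R u - of_int j *\<^sub>R g \<in> L"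
      using y u
    proof (cases rule: dual_cases)
      case 1
      then obtain j where "y - of_int j *\<^sub>R g \<in> L" using K_decompose[OF g] by blast
      then show ?thesis by (intro exI[of _ 0] exI[of _ j]) simp
    next
      case 2
      then obtain j where "y - u - of_int j *\<^sub>R g \<in> L" using K_decompose[OF g] by blast
      then show ?thesis by (intro exI[of _ 1] exI[of _ j]) simp
    qed
    then obtain i j where ij: "y - of_int i *\<^sub>R u - of_int j *\<^sub>R g \<in> L" by blast
    \<comment> \<open>Chinese remainder: \<open>k\<close> is \<open>i\<close> modulo 2 and
      \<open>j\<close> modulo 3.\<close>
    define k where "k = 3 * i - 2 * j"
    have "even (i - k)" "3 dvd j - k" unfolding k_def by presburger+
    then have "of_int (i - k) *\<^sub>R u + of_int (j - k) *\<^sub>R g \<in> L"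
      by (intro add_subgroupD(4)[OF add_subgroup_L] mult_u) (simp_all only: mult_g)
    from add_subgroupD(4)[OF add_subgroup_L ij this] have "y - of_int k *\<^sub>R h \<in> L"
      by (simp add: h_def algebra_simps)
    then show ?thesis by blast
  qed
  have LD: "L \<subseteq> ?D" using L_subset_K K_subset_dual by blast
  note cyc = D add_subgroup_L LD hD _ ex iff
  show "additive_group ?D Mod L \<cong> integer_mod_group 6"
    by (rule cyclic_quotient_iso[OF cyc]) simp_all
  have "Re (\<Sum>k<6. cis (pi * (real k)\<^sup>2 * (h \<bullet> h))) > 0"
  proof -
    have T: "transversal ((\<lambda>k. of_nat k *\<^sub>R h) ` {..<6}) L ?D"
      by (rule cyclic_quotient_transversal[OF cyc]) simp_all
    have "inj_on (\<lambda>k. of_nat k *\<^sub>R h) {..<6}"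
      by (rule inj_on_cyclic_multiples[OF cyc]) simp_all
    then show ?thesis
      using milgram_sign(1)[OF T] by (simp add: sum.reindex power2_eq_square mult_ac)
  qed
  moreover have "3 dvd nrm g - 2"
  proof (rule ccontr)
    assume "\<not> 3 dvd nrm g - 2"
    then have "3 dvd nrm g - 1" using g(2) by presburger
    then obtain i where i: "nrm g = 3 * i + 1" by (metis dvdE diff_add_cancel)
    obtain k where k: "m = 2 * k" using m(2) by (rule evenE)
    obtain j where j: "g \<bullet> u = of_int j" using g(1) u by (auto simp: K_def elim: Ints_cases)
    \<comment> \<open>Modulo 2 the norms are \<open>u \<bullet> u = 1/2\<close> and
      \<open>g \<bullet> g = 2/3\<close>, whence \<open>7/6\<close> for \<open>h\<close>;
      \<open>c\<close> collects the even remainder.\<close>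
    define c where "c = int k + i + j"
    have "h \<bullet> h = u \<bullet> u + 2 * (g \<bullet> u) + g \<bullet> g"
      by (simp add: h_def inner_add_left inner_add_right inner_commute)
    also have "\<dots> = 7 / 6 + 2 * of_int c"
      using nrm_K(1)[OF g(1)] unfolding norm_U[OF u] j i k c_def by (simp add: field_simps)
    finally have hh: "h \<bullet> h = 7 / 6 + 2 * of_int c" .
    \<comment> \<open>In the uses below the explicit argument \<open>l\<close> counts the full turns
      in \<open>7 k^2 / 6 * pi\<close>.\<close>
    have cis_h: "cis (pi * (real k)\<^sup>2 * (h \<bullet> h)) = cis x" if "(real k)\<^sup>2 * 7 / 6 * pi = x + 2 * pi * of_int l" for k x l
    proof -
      have "pi * (real k)\<^sup>2 * (h \<bullet> h) = x + 2 * pi * of_int (l + (int k)\<^sup>2 * c)"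
        using that unfolding hh by (simp add: algebra_simps)
      then have "cis (pi * (real k)\<^sup>2 * (h \<bullet> h)) = cis x * cis (2 * pi * of_int (l + (int k)\<^sup>2 * c))"
        by (simp only: cis_mult)
      then show ?thesis by simp
    qed
    have "cis (pi * (real 0)\<^sup>2 * (h \<bullet> h)) = cis 0" by simp
    moreover have "cis (pi * (real 1)\<^sup>2 * (h \<bullet> h)) = cis (pi + pi / 6)"
      by (rule cis_h[of _ _ 0]) (simp add: field_simps)
    moreover have "cis (pi * (real 2)\<^sup>2 * (h \<bullet> h)) = cis (pi - pi / 3)"
      by (rule cis_h[of _ _ 2]) (simp add: field_simps)
    moreover have "cis (pi * (real 3)\<^sup>2 * (h \<bullet> h)) = cis (pi / 2)"
      by (rule cis_h[of _ _ 5]) (simp add: field_simps)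
    moreover have "cis (pi * (real 4)\<^sup>2 * (h \<bullet> h)) = cis (pi - pi / 3)"
      by (rule cis_h[of _ _ 9]) (simp add: field_simps)
    moreover have "cis (pi * (real 5)\<^sup>2 * (h \<bullet> h)) = cis (pi + pi / 6)"
      by (rule cis_h[of _ _ 14]) (simp add: field_simps)
    moreover have "{..<6} = {0, 1, 2, 3, 4, 5::nat}" by auto
    ultimately have "Re (\<Sum>k<6. cis (pi * (real k)\<^sup>2 * (h \<bullet> h)))
        = cos 0 + cos (pi + pi / 6) + cos (pi - pi / 3) + cos (pi / 2) + cos (pi - pi / 3) + cos (pi + pi / 6)"
      by (simp del: of_nat_numeral cos_periodic_pi2 cos_pi_minus)
    also have "\<dots> = - sqrt 3"
      by (simp only: cos_periodic_pi2 cos_pi_minus cos_30 cos_60 cos_zero cos_pi_half)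
    finally have "Re (\<Sum>k<6. cis (pi * (real k)\<^sup>2 * (h \<bullet> h))) = - sqrt 3" .
    then show False using \<open>Re (\<Sum>k<6. cis (pi * (real k)\<^sup>2 * (h \<bullet> h))) > 0\<close> by simp
  qed
  \<comment> \<open>Not being divisible by 3, \<open>nrm g\<close> is \<open>2 m + 1\<close> modulo
    3, so \<open>2 m + 1 = 2\<close> there.\<close>
  then have "3 dvd int m + 1"
    using nrm_K(2)[OF g(1)] g(2) by presburger
  then show "[int m = - 1] (mod 3)" by (simp add: cong_iff_dvd_diff)
qed

end

section \<open>From the rescaled design back to the original one\<close>

lemma even_int_span_scaleR:
  fixes X :: "'a::real_vector set"
  assumes "r \<noteq> 0"
  shows "even_int_span ((*\<^sub>R) r ` X) = (*\<^sub>R) r ` even_int_span X"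
proof -
  have inj: "inj_on ((*\<^sub>R) r) X" using assms by (auto simp: inj_on_def)
  have eq: "(\<Sum>u\<in>(*\<^sub>R) r ` X. of_int (c u) *\<^sub>R u) = r *\<^sub>R (\<Sum>x\<in>X. of_int (c (r *\<^sub>R x)) *\<^sub>R x)"
    "(\<Sum>u\<in>(*\<^sub>R) r ` X. c u) = (\<Sum>x\<in>X. c (r *\<^sub>R x))" for c :: "'a \<Rightarrow> int"
    by (simp_all add: sum.reindex[OF inj] scaleR_sum_right mult.commute)
  show ?thesis
  proof
    show "even_int_span ((*\<^sub>R) r ` X) \<subseteq> (*\<^sub>R) r ` even_int_span X"
    proof
      fix y assume "y \<in> even_int_span ((*\<^sub>R) r ` X)"
      then obtain c where "even (\<Sum>x\<in>X. c (r *\<^sub>R x))" "y = r *\<^sub>R (\<Sum>x\<in>X. of_int (c (r *\<^sub>R x)) *\<^sub>R x)"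
        unfolding even_int_span_def eq by blast
      then show "y \<in> (*\<^sub>R) r ` even_int_span X"
        unfolding even_int_span_def by (intro image_eqI CollectI exI[of _ "\<lambda>x. c (r *\<^sub>R x)"]) auto
    qed
    show "(*\<^sub>R) r ` even_int_span X \<subseteq> even_int_span ((*\<^sub>R) r ` X)"
    proof
      fix y assume "y \<in> (*\<^sub>R) r ` even_int_span X"
      then obtain c where "even (\<Sum>x\<in>X. c x)" "y = r *\<^sub>R (\<Sum>x\<in>X. of_int (c x) *\<^sub>R x)"
        unfolding even_int_span_def by blast
      then show "y \<in> even_int_span ((*\<^sub>R) r ` X)"
        unfolding even_int_span_def eq using assms
        by (intro CollectI exI[of _ "\<lambda>u. c ((1 / r) *\<^sub>R u)"]) simp
    qed
  qed
qed

theorem theorem4p6: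
  fixes m d :: nat
    and X \<Lambda> \<Lambda>plus \<Gamma> :: "(real ^ 'n) set"
  assumes "m \<ge> 1"
    and "d = 2 * m + 1"
    and "CARD('n) = d\<^sup>2 - 2"
    and "X \<inter> uminus ` X = {}"
    and "X \<union> uminus ` X \<subseteq> {x. x \<bullet> x = real d}"
    and "tight_spherical_5_design (sqrt (real d)) (X \<union> uminus ` X)"
    and "\<Lambda> = int_span X"
    and "\<Lambda>plus = even_int_span X"
    and "\<Gamma> = (\<lambda>x. (1 / sqrt 2) *\<^sub>R x) ` \<Lambda>plus"
    and "\<forall>p. prime p \<and> odd p \<longrightarrow> \<not> p\<^sup>2 dvd m * (m + 1)"
    and "even m"
    and "\<not> 8 dvd m"
  shows "additive_group (dual_lattice \<Gamma>) Mod \<Gamma> \<cong> integer_mod_group 6 \<and> [int m = - 1] (mod 3)"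
proof -
  define U where "U = (*\<^sub>R) (1 / sqrt 2) ` X"
  note half = tight_5_design_half[OF assms(1,2,3,4,6)]
  have norm_X: "x \<bullet> x = real d" if "x \<in> X" for x using assms(5) that by auto
  have sum_U: "(\<Sum>u\<in>U. f u) = (\<Sum>x\<in>X. f ((1 / sqrt 2) *\<^sub>R x))" for f :: "real ^ 'n \<Rightarrow> real"
    unfolding U_def by (subst sum.reindex) (auto simp: inj_on_def)
  have inner: "((1 / sqrt 2) *\<^sub>R x) \<bullet> ((1 / sqrt 2) *\<^sub>R y) = (x \<bullet> y) / 2" for x y :: "real ^ 'n"
    by (simp flip: power2_eq_square)
  have sqrt4: "sqrt 2 ^ 4 = (4 :: real)"
    by (simp add: power4_eq_xxxx flip: mult.assoc)
  interpret scaled_design m U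
  proof
    show "m \<ge> 1" "even m" "\<not> 8 dvd m" by fact+
    show "\<not> p\<^sup>2 dvd m * (m + 1)" if "prime p" "odd p" for p using assms(10) that by blast
    show "finite U" using half(2) by (simp add: U_def)
    show "u \<bullet> u = real (2 * m + 1) / 2" if "u \<in> U" for u
      using that norm_X assms(2) by (auto simp: U_def inner simp del: inner_scaleR_left inner_scaleR_right)
    show "u \<bullet> v = 1 / 2 \<or> u \<bullet> v = - 1 / 2" if uv: "u \<in> U" "v \<in> U" "u \<noteq> v" for u v
    proof -
      obtain x y where xy: "x \<in> X" "y \<in> X" "u = (1 / sqrt 2) *\<^sub>R x" "v = (1 / sqrt 2) *\<^sub>R y"
        using uv unfolding U_def by blast
      have "x \<bullet> y = 1 \<or> x \<bullet> y = - 1"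
        using uv(3) xy by (intro tight_5_design_inner[OF assms(1,2,3,4,6)] norm_X) auto
      then show ?thesis unfolding xy inner by auto
    qed
    show "(\<Sum>u\<in>U. (u \<bullet> y)\<^sup>2) = real m * (real m + 1) * real (2 * m + 1) * (y \<bullet> y)" for y
    proof -
      have "(\<Sum>u\<in>U. (u \<bullet> y)\<^sup>2) = (\<Sum>x\<in>X. (x \<bullet> y)\<^sup>2) / 2"
        unfolding sum_U by (simp add: power_divide sum_divide_distrib)
      then show ?thesis unfolding half(4) using assms(2) by simp
    qed
    show "(\<Sum>u\<in>U. (u \<bullet> y) ^ 4) = 3 / 2 * (real m * (real m + 1)) * (y \<bullet> y)\<^sup>2" for y
    proof -
      have "(\<Sum>u\<in>U. (u \<bullet> y) ^ 4) = (\<Sum>x\<in>X. (x \<bullet> y) ^ 4) / 4"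
        unfolding sum_U by (simp add: power_divide sum_divide_distrib sqrt4)
      then show ?thesis unfolding half(5) by simp
    qed
    show "DIM(real ^ 'n) + 1 = 4 * (m * (m + 1))" using half(1) by simp
  qed
  have "even_int_span U = \<Gamma>"
    unfolding U_def assms(8,9) by (rule even_int_span_scaleR) simp
  then show ?thesis using discriminant by simp
qed

end
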